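(* For any $E\subset\mathbb{R}^n$ that is a countable union of cone unrectifiable $F_\sigma$ sets there is a Lipschitz function $f:\mathbb{R}^n\to\mathbb{R}$ that is non-differentiable at every point of $E$ and is differentiable at every point of its complement $\mathbb{R}^n\setminus E$.
   Context: $\mathbb{R}^n$ carries the Euclidean norm $\|\cdot\|$ and inner product $\langle\cdot,\cdot\rangle$; $B(x,r)$ is the open ball; $\mathcal{H}^1$ is one-dimensional Hausdorff measure. Width. For $e\in\mathbb{R}^n\setminus\{0\}$ and $\alpha\in(0,1]$ let $C_{e,\alpha}=\{x\in\mathbb{R}^n:\langle x,e\rangle\ge\alpha\|x\|\|e\|\}$ and let $\Gamma_{e,\alpha}$ be the set of Lipschitz curves $\gamma:\mathbb{R}\to\mathbb{R}^n$ such that $\gamma'(t)\in C_{e,\alpha}$ for almost every $t\in\mathbb{R}$. For open $G\subset\mathbb{R}^n$ let $w_{e,\alpha}(G)=\sup\{\mathcal{H}^1(G\cap\gamma(\mathbb{R})):\gamma\in\Gamma_{e,\alpha}\}$, and for arbitrary $E\subset\mathbb{R}^n$ let $w_{e,\alpha}(E)=\inf\{w_{e,\alpha}(G):G\supset E,\ G\text{ open}\}$. When $e=0$ or $\alpha>1$, $w_{e,\alpha}(E)=0$ for every $E\subset\mathbb{R}^n$. For $x\in E\subset\mathbb{R}^n$ let $\mathcal{N}(E,x)=\{e\in\mathbb{R}^n:(\forall\varepsilon>0)(\exists r>0)\ w_{e,\varepsilon}(B(x,r)\cap E)=0\}$. A set $E\subset\mathbb{R}^n$ is cone unrectifiable if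 $\mathcal{N}(E,x)\neq\{0\}$ for every $x\in E$. *)

theory Defs
  imports "HOL-Analysis.Analysis"
begin

text \<open>
  One-dimensional Hausdorff measure by Caratheodory's construction.  Boundedness of the covering
  sets is required explicitly because \<^const>\<open>diameter\<close> is \<open>0\<close> by convention on unbounded sets.
\<close>

definition hausdorff1_pre :: "real \<Rightarrow> 'a::metric_space set \<Rightarrow> ennreal" where
  "hausdorff1_pre \<delta> A =
     Inf {(\<Sum>i. ennreal (diameter (C i))) | C :: nat \<Rightarrow> 'a set.
            A \<subseteq> (\<Union>i. C i) \<and> (\<forall>i. bounded (C i) \<and> diameter (C i) \<le> \<delta>)}"

definition hausdorff1 :: "'a::metric_space set \<Rightarrow> ennreal" where
  "hausdorff1 A = (SUP \<delta>\<in>{0<..}. hausdorff1_pre \<delta> A)"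

definition cone :: "real^'n \<Rightarrow> real \<Rightarrow> (real^'n) set" where
  "cone e \<alpha> = {x. x \<bullet> e \<ge> \<alpha> * norm x * norm e}"

definition cone_curves :: "real^'n \<Rightarrow> real \<Rightarrow> (real \<Rightarrow> real^'n) set" where
  "cone_curves e \<alpha> =
     {\<gamma>. (\<exists>L. L-lipschitz_on UNIV \<gamma>) \<and>
         (AE t in lebesgue. \<exists>v\<in>cone e \<alpha>. (\<gamma> has_vector_derivative v) (at t))}"

definition width_open :: "real^'n \<Rightarrow> real \<Rightarrow> (real^'n) set \<Rightarrow> ennreal" where
  "width_open e \<alpha> G = (SUP \<gamma>\<in>cone_curves e \<alpha>. hausdorff1 (G \<inter> range \<gamma>))"

text \<open>Only apertures \<open>\<alpha> > 0\<close> are meaningful; the values for \<open>\<alpha> \<le> 0\<close> are never used.\<close>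

definition width :: "real^'n \<Rightarrow> real \<Rightarrow> (real^'n) set \<Rightarrow> ennreal" where
  "width e \<alpha> E =
     (if e = 0 \<or> \<alpha> > 1 then 0 else (INF G\<in>{G. open G \<and> E \<subseteq> G}. width_open e \<alpha> G))"

lemma hausdorff1_mono: "A \<subseteq> B \<Longrightarrow> hausdorff1 A \<le> hausdorff1 B"
  unfolding hausdorff1_def hausdorff1_pre_def
  by (intro SUP_mono' Inf_superset_mono) blast

lemma width_eq_width_open:
  assumes "open G" "e \<noteq> 0" "\<alpha> \<le> 1"
  shows "width e \<alpha> G = width_open e \<alpha> G"
proof -
  have "width_open e \<alpha> G \<le> width_open e \<alpha> H" if "G \<subseteq> H" for H
    unfolding width_open_def using that by (intro SUP_mono' hausdorff1_mono) blast
  then show ?thesis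
    using assms unfolding width_def by (auto intro!: antisym INF_lower INF_greatest)
qed

definition normal_cone :: "(real^'n) set \<Rightarrow> real^'n \<Rightarrow> (real^'n) set" where
  "normal_cone E x = {e. \<forall>\<epsilon>>0. \<exists>r>0. width e \<epsilon> (ball x r \<inter> E) = 0}"

definition cone_unrectifiable :: "(real^'n) set \<Rightarrow> bool" where
  "cone_unrectifiable E \<longleftrightarrow> (\<forall>x\<in>E. normal_cone E x \<noteq> {0})"

end

theory Submission
  imports Defs
begin

text \<open>
  If a compact set has zero width in direction \<open>e\<close>, then it has a neighbourhood carrying an arbitrarily
  small function with gradient close to \<open>e\<close> near the set and close to the segment from \<open>0\<close> to \<open>e\<close>
  everywhere.  For a compact cone unrectifiable set \<open>K\<close>, gluing such functions with a partition of
  unity and subtracting a much smaller function of the same kind gives an increment whose gradient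
  first rises to a definite size and then returns to almost \<open>0\<close> closer to \<open>K\<close>.  Because the gradient
  is brought back to \<open>0\<close> along the same directions before new ones are chosen, a series of such
  increments on shrinking neighbourhoods of \<open>K\<close> is Lipschitz although the admissible directions vary
  with the point and the scale; its difference quotients at points of \<open>K\<close> oscillate between large
  and small.  A countable union of compact sets is handled by a series with rapidly decreasing weights.
\<close>

subsection \<open>Value function of the steering problem\<close>

text \<open>Null width is used only through graphs: for unit \<open>e\<close>, a graph over the line
  of \<open>e\<close> with sideways speed at most \<open>1 / \<epsilon>\<close> belongs to
  \<open>cone_curves e (\<epsilon> / 2)\<close>, so it collects little height inside a suitable open
  set. Dually, a function that may change sideways at rate \<epsilon> can climb at rate 1 along
  \<open>e\<close> in that set and still be small.

  The order of quantifiers in \<open>full_stage\<close> carries the summation: the slope bound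
  \<open>M\<close> and the oscillation \<open>c\<close> come before the flatness \<open>d\<close>
  near \<open>K\<close> and the scale \<rho>. So the flatness constants can be made summable, and at
  each point at most two stages are neither flat nor zero.

  Non-differentiability alone would not survive the sum over countably many sets. The quantitative
  \<open>oscillates\<close> does, because it tolerates perturbations with a small Lipschitz
  constant. Compact pieces give uniform neighbourhoods; off each of them the series of stages is
  locally finite, hence differentiable.\<close>

definition perp :: "'a::real_inner \<Rightarrow> 'a \<Rightarrow> 'a" where
  "perp e x = x - (x \<bullet> e) *\<^sub>R e"

text \<open>Differentiability off a finite set is built in so that membership in
  \<open>cone_curves\<close> can be checked without Rademacher's theorem.\<close>

definition steep_graphs :: "'a::real_inner \<Rightarrow> real \<Rightarrow> (real \<Rightarrow> 'a) set" where
  "steep_graphs e k = {s. k-lipschitz_on UNIV s \<and> (\<forall>t. s t \<bullet> e = 0) \<and>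
     (\<exists>S. finite S \<and> (\<forall>t. t \<notin> S \<longrightarrow> s differentiable (at t)))}"

definition visits :: "'a::real_inner \<Rightarrow> 'a set \<Rightarrow> (real \<Rightarrow> 'a) \<Rightarrow> real \<Rightarrow> real set" where
  "visits e G s T = {t. t \<le> T \<and> t *\<^sub>R e + s t \<in> G}"

text \<open>
  The function with steep gradient is the value of a control problem: a graph over the line spanned
  by \<open>e\<close> is followed up to height \<open>T\<close>, the time spent in \<open>G\<close> is rewarded, and ending away from \<open>x\<close>
  is penalised.  The penalty makes the value Lipschitz with the exact one-sided increments needed;
  the lateral price \<open>1 / k\<close> is chosen so that steering sideways at the maximal speed \<open>k\<close> reduces the
  penalty as fast as staying in \<open>G\<close> would earn reward.
\<close>

definition reward :: "'a::real_inner \<Rightarrow> real \<Rightarrow> 'a set \<Rightarrow> 'a \<Rightarrow> (real \<Rightarrow> 'a) \<Rightarrow> real \<Rightarrow> real" where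
  "reward e k G x s T =
     measure lborel (visits e G s T) - max 0 (T - x \<bullet> e) - norm (s T - perp e x) / k"

definition payoff :: "'a::real_inner \<Rightarrow> real \<Rightarrow> 'a set \<Rightarrow> 'a \<Rightarrow> real" where
  "payoff e k G x = (SUP (s, T)\<in>steep_graphs e k \<times> UNIV. reward e k G x s T)"

lemma perp_diff: "perp e x - perp e y = perp e (x - y)"
  by (simp add: perp_def algebra_simps)

lemma perp_inner: "norm e = 1 \<Longrightarrow> perp e x \<bullet> e = 0"
  by (simp add: perp_def inner_diff_left norm_eq_1)

lemma perp_add_axis: "norm e = 1 \<Longrightarrow> perp e (x + c *\<^sub>R e) = perp e x"
  by (simp add: perp_def algebra_simps norm_eq_1)

lemma perp_decomp: "x = (x \<bullet> e) *\<^sub>R e + perp e x"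
  by (simp add: perp_def)

lemma const_in_steep_graphs: "0 \<le> k \<Longrightarrow> p \<bullet> e = 0 \<Longrightarrow> (\<lambda>_. p) \<in> steep_graphs e k"
  by (auto simp: steep_graphs_def lipschitz_on_def intro!: exI[of _ "{}"])

lemma steep_graph_continuous:
  assumes "s \<in> steep_graphs e k"
  shows "continuous_on UNIV (\<lambda>t. t *\<^sub>R e + s t)"
  using assms lipschitz_on_continuous_on[of k UNIV s]
  by (auto simp: steep_graphs_def intro!: continuous_intros)

lemma visits_borel:
  assumes "s \<in> steep_graphs e k" "open G"
  shows "visits e G s T \<in> sets borel"
proof -
  have "open {t. t *\<^sub>R e + s t \<in> G}"
    using open_vimage[OF assms(2) steep_graph_continuous[OF assms(1)]] by (simp add: vimage_def)
  moreover have "visits e G s T = {..T} \<inter> {t. t *\<^sub>R e + s t \<in> G}"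
    by (auto simp: visits_def)
  ultimately show ?thesis by auto
qed

lemma lipschitz_on_UNIV_concat:
  fixes f g :: "real \<Rightarrow> 'a::metric_space"
  assumes f: "k-lipschitz_on UNIV f" and g: "k-lipschitz_on UNIV g" and fg: "f T = g T"
  shows "k-lipschitz_on UNIV (\<lambda>t. if t \<le> T then f t else g t)"
proof (rule lipschitz_onI)
  fix x y :: real
  let ?a = "min T (min x y)" and ?c = "max T (max x y)"
  have "k-lipschitz_on {?a..?c} (\<lambda>t. if t \<le> T then f t else g t)"
    by (rule lipschitz_on_concat) (auto intro: lipschitz_on_subset[OF f] lipschitz_on_subset[OF g] fg)
  then show "dist (if x \<le> T then f x else g x) (if y \<le> T then f y else g y) \<le> k * dist x y"
    by (rule lipschitz_onD) auto
qed (use f lipschitz_on_nonneg in blast)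

text \<open>Follow \<open>s\<close> up to \<open>T\<close>, then run straight to \<open>p\<close> at
  the maximal speed \<open>k\<close> and rest there. This later turns a path for \<open>x\<close>
  into a competitor for a higher point of the line through \<open>x\<close> in direction
  \<open>e\<close>.\<close>

lemma steer:
  fixes p :: "'a::real_inner"
  assumes s: "s \<in> steep_graphs e k" and p: "p \<bullet> e = 0" and k: "k > 0"
  shows "\<exists>s'\<in>steep_graphs e k. (\<forall>t\<le>T. s' t = s t) \<and>
           (\<forall>t\<ge>T. norm (s' t - p) = max 0 (norm (s T - p) - k * (t - T)))"
proof -
  define d where "d = norm (s T - p)"
  \<comment> \<open>If \<open>d = 0\<close>, division by zero gives \<open>c t = 1\<close>, harmless
    because \<open>s T - p\<close> vanishes.\<close>
  define c where "c t = max 0 (1 - k * (t - T) / d)" for t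
  define r where "r t = p + c t *\<^sub>R (s T - p)" for t
  define s' where "s' t = (if t \<le> T then s t else r t)" for t
  have d0: "d \<ge> 0" by (simp add: d_def)
  have norm_r: "norm (r t - p) = max 0 (d - k * (t - T))" if "t \<ge> T" for t
  proof (cases "d = 0")
    case True
    then have "s T = p" by (simp add: d_def)
    then show ?thesis using True that k by (simp add: r_def)
  next
    case False
    then have "norm (r t - p) = c t * d" by (simp add: r_def d_def c_def)
    also have "\<dots> = max 0 (d - k * (t - T))"
      using False d0 by (simp add: c_def max_def field_simps)
    finally show ?thesis .
  qed
  have r_lip: "k-lipschitz_on UNIV r"
  proof (rule lipschitz_onI)
    fix x y :: real
    show "dist (r x) (r y) \<le> k * dist x y"
    proof (cases "d = 0")
      case True
      then show ?thesis using k by (simp add: r_def d_def)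
    next
      case False
      have "dist (r x) (r y) = \<bar>c x - c y\<bar> * d"
        by (simp add: r_def d_def dist_norm flip: scaleR_diff_left)
      also have "\<bar>c x - c y\<bar> \<le> \<bar>(1 - k * (x - T) / d) - (1 - k * (y - T) / d)\<bar>"
        unfolding c_def by (auto simp: max_def)
      also have "\<dots> = k * \<bar>x - y\<bar> / d"
      proof -
        have "(1 - k * (x - T) / d) - (1 - k * (y - T) / d) = - (k * (x - y) / d)"
          by (simp add: field_simps diff_divide_distrib)
        then show ?thesis using k d0 by (simp add: abs_mult)
      qed
      finally show ?thesis using False d0 by (simp add: dist_real_def mult_right_mono)
    qed
  qed (use k in simp)
  have s_lip: "k-lipschitz_on UNIV s" using s by (simp add: steep_graphs_def)
  have "r T = s T" by (simp add: r_def c_def)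
  then have lip: "k-lipschitz_on UNIV s'"
    unfolding s'_def by (intro lipschitz_on_UNIV_concat s_lip r_lip) simp
  have orth: "s' t \<bullet> e = 0" for t
    using s p by (simp add: s'_def r_def steep_graphs_def inner_add_left inner_diff_left)
  obtain S where S: "finite S" "\<And>t. t \<notin> S \<Longrightarrow> s differentiable (at t)"
    using s by (auto simp: steep_graphs_def)
  \<comment> \<open>New corners arise only where the steering begins and where it reaches
    \<open>p\<close>.\<close>
  have "s' differentiable (at t)" if t: "t \<notin> S \<union> {T, T + d / k}" for t
  proof -
    consider "t < T" | "t > T" "t < T + d / k" | "t > T" "t > T + d / k"
      using t by fastforce
    then show ?thesis
    proof cases
      case 1
      have "s differentiable (at t)" using S t by auto
      then obtain D where "(s has_derivative D) (at t)" by (auto simp: differentiable_def)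
      then have "(s' has_derivative D) (at t)"
        by (rule has_derivative_transform_within_open[of _ _ _ _ "{..<T}"]) (use 1 in \<open>auto simp: s'_def\<close>)
      then show ?thesis by (auto simp: differentiable_def)
    next
      case 2
      have "(\<lambda>t. p + (1 - k * (t - T) / d) *\<^sub>R (s T - p)) differentiable (at t)"
        by (cases "d = 0") (auto intro!: derivative_intros)
      then obtain D where D: "((\<lambda>t. p + (1 - k * (t - T) / d) *\<^sub>R (s T - p)) has_derivative D) (at t)"
        by (auto simp: differentiable_def)
      have "d / k > 0" using 2 by linarith
      then have dpos: "d > 0" using k by (simp add: zero_less_divide_iff)
      have eq: "p + (1 - k * (x - T) / d) *\<^sub>R (s T - p) = s' x" if x: "x \<in> {T<..<T + d / k}" for x
      proof -
        have "x - T < d / k" using x by auto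
        then have "k * (x - T) < d" using k by (simp add: pos_less_divide_eq mult.commute)
        then have "k * (x - T) / d < 1" using dpos by simp
        then show ?thesis using x by (simp add: s'_def r_def c_def)
      qed
      have "(s' has_derivative D) (at t)"
        by (rule has_derivative_transform_within_open[OF D, of "{T<..<T + d / k}"])
          (use 2 eq in auto)
      then show ?thesis by (auto simp: differentiable_def)
    next
      case 3
      have "s' x = p" if "T < x" "T + d / k < x" for x
      proof -
        have "d < k * (x - T)" using that(2) k by (simp add: field_simps)
        then have "norm (r x - p) = 0" using norm_r[of x] that by simp
        then show ?thesis using that by (simp add: s'_def)
      qed
      note eq = this
      have "((\<lambda>_. p) has_derivative (\<lambda>_. 0)) (at t)" by simp
      then have "(s' has_derivative (\<lambda>_. 0)) (at t)"
        by (rule has_derivative_transform_within_open[of _ _ _ _ "{T<..} \<inter> {T + d / k<..}"])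
          (use 3 eq in auto)
      then show ?thesis by (auto simp: differentiable_def)
    qed
  qed
  then have "s' \<in> steep_graphs e k"
    using lip orth S(1) by (auto simp: steep_graphs_def intro!: exI[of _ "S \<union> {T, T + d / k}"])
  moreover have "norm (s' t - p) = max 0 (d - k * (t - T))" if "t \<ge> T" for t
    using norm_r[OF that] \<open>r T = s T\<close> that by (cases "t = T") (auto simp: s'_def)
  ultimately show ?thesis unfolding d_def
    by (intro bexI[of _ s']) (auto simp: s'_def)
qed

text \<open>The constant graph through \<open>x\<close>, stopped at the height of \<open>x\<close>,
  pays no penalty.\<close>

lemma exists_nonneg_reward:
  assumes "norm e = 1" "k > 0"
  shows "\<exists>(s, T)\<in>steep_graphs e k \<times> UNIV. reward e k G x s T \<ge> 0"
  using const_in_steep_graphs[of k "perp e x" e] perp_inner[of e x] assms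
  by (intro bexI[of _ "(\<lambda>_. perp e x, x \<bullet> e)"]) (auto simp: reward_def)

section \<open>Bounds on the payoff when every steep graph spends little time in
  \<open>G\<close>\<close>

context
  fixes e :: "'a::euclidean_space" and k \<eta> :: real and G :: "'a set"
  assumes e: "norm e = 1" and k: "k > 0" and G: "open G"
    and short: "\<And>s. s \<in> steep_graphs e k \<Longrightarrow> emeasure lborel {t. t *\<^sub>R e + s t \<in> G} \<le> ennreal \<eta>"
    and eta: "\<eta> \<ge> 0"
begin

lemma visits_fmeasurable: "s \<in> steep_graphs e k \<Longrightarrow> visits e G s T \<in> fmeasurable lborel"
proof -
  assume s: "s \<in> steep_graphs e k"
  have "open {t. t *\<^sub>R e + s t \<in> G}"
    using open_vimage[OF G steep_graph_continuous[OF s]] by (simp add: vimage_def)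
  then have "emeasure lborel (visits e G s T) \<le> emeasure lborel {t. t *\<^sub>R e + s t \<in> G}"
    by (intro emeasure_mono) (auto simp: visits_def)
  also have "\<dots> \<le> ennreal \<eta>" by (rule short[OF s])
  finally have "emeasure lborel (visits e G s T) < \<infinity>"
    by (metis ennreal_less_top infinity_ennreal_def order_le_less_trans)
  then show ?thesis using visits_borel[OF s G] by (auto simp: fmeasurable_def)
qed

lemma measure_visits_le: "s \<in> steep_graphs e k \<Longrightarrow> measure lborel (visits e G s T) \<le> \<eta>"
proof -
  assume s: "s \<in> steep_graphs e k"
  have "open {t. t *\<^sub>R e + s t \<in> G}"
    using open_vimage[OF G steep_graph_continuous[OF s]] by (simp add: vimage_def)
  then have "emeasure lborel (visits e G s T) \<le> emeasure lborel {t. t *\<^sub>R e + s t \<in> G}"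
    by (intro emeasure_mono) (auto simp: visits_def)
  also have "\<dots> \<le> ennreal \<eta>" by (rule short[OF s])
  finally show ?thesis using eta by (simp add: measure_def enn2real_leI)
qed

lemma reward_le: "s \<in> steep_graphs e k \<Longrightarrow> reward e k G x s T \<le> \<eta>"
  using measure_visits_le[of s T] k by (simp add: reward_def add_nonneg_nonneg diff_le_eq add_increasing2)

lemma reward_bdd: "bdd_above ((\<lambda>(s, T). reward e k G x s T) ` (steep_graphs e k \<times> UNIV))"
  by (rule bdd_aboveI[of _ \<eta>]) (auto intro: reward_le)

lemma reward_le_payoff: "s \<in> steep_graphs e k \<Longrightarrow> reward e k G x s T \<le> payoff e k G x"
  unfolding payoff_def using cSUP_upper[OF _ reward_bdd, of "(s, T)" x] by auto

lemma payoff_leI: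
  assumes "\<And>s T. s \<in> steep_graphs e k \<Longrightarrow> reward e k G x s T \<le> b"
  shows "payoff e k G x \<le> b"
  unfolding payoff_def
  by (rule cSUP_least) (use exists_nonneg_reward[OF e k] assms in auto)

lemma payoff_le: "payoff e k G x \<le> \<eta>"
  by (rule payoff_leI) (rule reward_le)

lemma payoff_nonneg: "0 \<le> payoff e k G x"
proof -
  obtain s T where "s \<in> steep_graphs e k" "0 \<le> reward e k G x s T"
    using exists_nonneg_reward[OF e k, of G x] by auto
  then show ?thesis using reward_le_payoff[of s x T] by linarith
qed

text \<open>For a fixed pair \<open>(s, T)\<close> the base point enters only through the two
  penalties, and the supremum inherits their change. Along \<open>- e\<close> the payoff cannot
  increase; this is what confines the later gradient to the segment from 0 to \<open>e\<close>, up
  to \<open>1 / k\<close>.\<close>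

lemma payoff_increment_le:
  "payoff e k G y - payoff e k G x \<le> max 0 ((y - x) \<bullet> e) + norm (perp e (y - x)) / k"
proof -
  have "payoff e k G y \<le> payoff e k G x + (max 0 ((y - x) \<bullet> e) + norm (perp e (y - x)) / k)"
  proof (rule payoff_leI)
    fix s T assume s: "s \<in> steep_graphs e k"
    have "norm (s T - perp e x) \<le> norm (s T - perp e y) + norm (perp e (y - x))"
      using norm_triangle_ineq[of "s T - perp e y" "perp e y - perp e x"] by (simp add: perp_diff[symmetric])
    then have "norm (s T - perp e x) / k \<le> norm (s T - perp e y) / k + norm (perp e (y - x)) / k"
      using k by (simp add: divide_right_mono flip: add_divide_distrib)
    moreover have "max 0 (T - x \<bullet> e) \<le> max 0 (T - y \<bullet> e) + max 0 ((y - x) \<bullet> e)"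
      by (auto simp: max_def inner_diff_left)
    ultimately have "reward e k G y s T \<le> reward e k G x s T + (max 0 ((y - x) \<bullet> e) + norm (perp e (y - x)) / k)"
      by (simp add: reward_def)
    then show "reward e k G y s T \<le> payoff e k G x + (max 0 ((y - x) \<bullet> e) + norm (perp e (y - x)) / k)"
      using reward_le_payoff[OF s, of x T] by simp
  qed
  then show ?thesis by simp
qed

text \<open>Every competitor for \<open>x\<close> yields one for the point \<open>r\<close> higher
  that earns at least \<open>r\<close> more: either the height penalty drops, or the path is
  prolonged towards the line through \<open>x\<close>, and the extra time pays at rate 1, first as
  reduced lateral penalty and then as time in \<open>G\<close>.\<close>

lemma payoff_axis_ge:
  assumes "r \<ge> 0" and seg: "\<And>t. 0 \<le> t \<Longrightarrow> t \<le> r \<Longrightarrow> x + t *\<^sub>R e \<in> G"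
  shows "payoff e k G (x + r *\<^sub>R e) \<ge> payoff e k G x + r"
proof -
  have "payoff e k G x \<le> payoff e k G (x + r *\<^sub>R e) - r"
  proof (rule payoff_leI)
    fix s T assume s: "s \<in> steep_graphs e k"
    define y where "y = x + r *\<^sub>R e"
    define p where "p = perp e x"
    have py: "perp e y = p" using e by (simp add: y_def p_def perp_add_axis)
    define h where "h = x \<bullet> e"
    have ye: "y \<bullet> e = h + r" using e by (simp add: y_def h_def inner_add_left norm_eq_1)
    define d where "d = norm (s T - p)"
    have d0: "d \<ge> 0" by (simp add: d_def)
    obtain s' T' where s': "s' \<in> steep_graphs e k"
      and rew: "reward e k G y s' T' \<ge> reward e k G x s T + r"
    proof (cases "T \<ge> h + r")
      case True
      then have "reward e k G y s T \<ge> reward e k G x s T + r"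
        using \<open>r \<ge> 0\<close> py ye by (simp add: reward_def flip: p_def h_def)
      then show thesis using that s by blast
    next
      case False
      define T' where "T' = h + r"
      have "p \<bullet> e = 0" using e by (simp add: p_def perp_inner)
      from steer[OF s this k, of T] obtain s' where s': "s' \<in> steep_graphs e k"
        and before: "\<And>t. t \<le> T \<Longrightarrow> s' t = s t"
        and after: "\<And>t. t \<ge> T \<Longrightarrow> norm (s' t - p) = max 0 (d - k * (t - T))"
        unfolding d_def by blast
      have sub: "visits e G s T \<subseteq> visits e G s' T'"
        using False before by (auto simp: visits_def T'_def)
      show thesis
      proof (cases "k * (T' - T) < d")
        \<comment> \<open>The line is not reached by \<open>T'\<close>: the lateral penalty drops by
          \<open>T' - T\<close>, and \<open>T' - T + max 0 (T - h) \<ge> r\<close>.\<close>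
        case True
        have "norm (s' T' - p) = d - k * (T' - T)"
          using after[of T'] True False by (simp add: T'_def)
        then have "norm (s' T' - p) / k = d / k - (T' - T)"
          using k by (simp add: field_simps)
        moreover have "measure lborel (visits e G s T) \<le> measure lborel (visits e G s' T')"
          by (rule measure_mono_fmeasurable) (use sub visits_fmeasurable[OF s'] visits_borel[OF s G] in auto)
        ultimately have "reward e k G y s' T' \<ge> reward e k G x s T + r"
          using py ye by (simp add: reward_def T'_def flip: p_def h_def d_def)
        then show ?thesis using that s' by blast
      next
        case reached: False
        \<comment> \<open>After \<open>A\<close> the graph has reached the line and passed the
          height \<open>h\<close> of \<open>x\<close>, so it runs inside the segment assumed to lie
          in \<open>G\<close>.\<close>
        define A where "A = max (T + d / k) h"
        have A: "A \<le> T'" "T \<le> A"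
          using reached k d0 \<open>r \<ge> 0\<close> by (auto simp: A_def T'_def field_simps le_max_iff_disj)
        have "t *\<^sub>R e + s' t \<in> G" if "A < t" "t \<le> T'" for t
        proof -
          have t: "T + d / k < t" "h < t" "t \<le> h + r" using that by (auto simp: A_def T'_def)
          have "d < k * (t - T)" using t(1) k by (simp add: field_simps)
          then have "s' t = p" using after[of t] that A by simp
          moreover have "t *\<^sub>R e + p = x + (t - h) *\<^sub>R e"
            by (simp add: p_def perp_def h_def algebra_simps)
          ultimately show ?thesis using seg[of "t - h"] t by simp
        qed
        then have sub2: "visits e G s T \<union> {A<..T'} \<subseteq> visits e G s' T'"
          using sub A by (auto simp: visits_def)
        have "measure lborel (visits e G s T) + (T' - A) = measure lborel (visits e G s T \<union> {A<..T'})"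
        proof -
          have "measure lborel {A<..T'} = T' - A" using A by simp
          moreover have "measure lborel (visits e G s T \<union> {A<..T'}) = measure lborel (visits e G s T) + measure lborel {A<..T'}"
          proof (rule measure_Union)
            show "visits e G s T \<inter> {A<..T'} = {}" using A by (auto simp: visits_def)
          qed (use visits_fmeasurable[OF s, of T] in \<open>auto simp: fmeasurable_def A\<close>)
          ultimately show ?thesis by simp
        qed
        also have "\<dots> \<le> measure lborel (visits e G s' T')"
          by (rule measure_mono_fmeasurable) (use sub2 visits_fmeasurable[OF s'] visits_borel[OF s G] in auto)
        finally have m: "measure lborel (visits e G s T) + (T' - A) \<le> measure lborel (visits e G s' T')" .
        have "norm (s' T' - p) = 0" using after[of T'] reached False by (simp add: T'_def)
        then have 1: "reward e k G y s' T' = measure lborel (visits e G s' T')"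
          using py ye by (simp add: reward_def T'_def)
        have 2: "reward e k G x s T = measure lborel (visits e G s T) - max 0 (T - h) - d / k"
          by (simp add: reward_def d_def h_def p_def)
        have "T' - A \<ge> r - max 0 (T - h) - d / k"
          using divide_nonneg_pos[OF d0 k] by (auto simp: T'_def A_def max_def)
        then have "reward e k G y s' T' \<ge> reward e k G x s T + r"
          using m 1 2 by linarith
        then show ?thesis using that s' by blast
      qed
    qed
    then show "reward e k G x s T \<le> payoff e k G (x + r *\<^sub>R e) - r"
      using reward_le_payoff[OF s', of y T'] by (simp add: y_def)
  qed
  then show ?thesis by simp
qed

end

subsection \<open>Mollification\<close>

text \<open>A polynomial bump with explicit derivative; once continuously differentiable is enough,
  as only first derivatives occur. It is left unnormalised: convolution divides by its integral, the
  partition functions by the central value \<open>r ^ 4\<close>.\<close>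

definition mollifier :: "real \<Rightarrow> 'a::real_inner \<Rightarrow> real" where
  "mollifier r z = (max 0 (r\<^sup>2 - z \<bullet> z))\<^sup>2"

lemma mollifier_nonneg: "mollifier r z \<ge> 0"
  by (simp add: mollifier_def)

lemma mollifier_minus: "mollifier r (- z) = mollifier r z"
  by (simp add: mollifier_def)

lemma mollifier_eq_0: "r > 0 \<Longrightarrow> norm z \<ge> r \<Longrightarrow> mollifier r z = 0"
  using power_mono[of r "norm z" 2] by (simp add: mollifier_def power2_norm_eq_inner)

lemma continuous_mollifier: "continuous_on UNIV (mollifier r)"
  unfolding mollifier_def by (intro continuous_intros)

lemma has_derivative_square_max_0:
  "((\<lambda>s::real. (max 0 s)\<^sup>2) has_real_derivative 2 * max 0 s) (at s)"
proof (cases s "0 :: real" rule: linorder_cases)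
  case less
  have "((\<lambda>_. 0) has_real_derivative 2 * max 0 s) (at s)" using less by simp
  then show ?thesis
    by (rule DERIV_cong_ev[THEN iffD1, OF refl _ refl, rotated])
      (use less in \<open>auto simp: eventually_nhds intro!: exI[of _ "{..<0}"]\<close>)
next
  case equal
  have "((\<lambda>h. (max 0 h)\<^sup>2 / h) \<longlongrightarrow> 0) (at (0::real))"
  proof (rule Lim_null_comparison)
    show "\<forall>\<^sub>F h in at (0::real). norm ((max 0 h)\<^sup>2 / h) \<le> \<bar>h\<bar>"
      by (auto simp: max_def power2_eq_square)
    show "((\<lambda>h. \<bar>h\<bar>) \<longlongrightarrow> 0) (at (0::real))" by (auto intro!: tendsto_eq_intros)
  qed
  then show ?thesis using equal by (simp add: DERIV_def)
next
  case greater
  have "((\<lambda>s. s\<^sup>2) has_real_derivative 2 * max 0 s) (at s)"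
    using greater by (auto intro!: derivative_eq_intros)
  then show ?thesis
    by (rule DERIV_cong_ev[THEN iffD1, OF refl _ refl, rotated])
      (use greater in \<open>auto simp: eventually_nhds intro!: exI[of _ "{0<..}"]\<close>)
qed

lemma has_derivative_mollifier:
  "(mollifier r has_derivative (\<lambda>v. - 4 * max 0 (r\<^sup>2 - z \<bullet> z) * (z \<bullet> v))) (at z)"
proof -
  have "((\<lambda>z. r\<^sup>2 - z \<bullet> z) has_derivative (\<lambda>v. - (2 * (z \<bullet> v)))) (at z)"
    by (auto intro!: derivative_eq_intros simp: inner_commute)
  from has_derivative_compose[OF this has_derivative_square_max_0[unfolded has_field_derivative_def]]
  show ?thesis by (simp add: mollifier_def[abs_def] mult.commute mult.left_commute)
qed

lemma integrable_mollifier: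
  fixes f :: "'a::euclidean_space \<Rightarrow> real"
  assumes f: "continuous_on UNIV f" and r: "r > 0"
  shows "integrable lborel (\<lambda>y. f y * mollifier r (x - y))"
proof -
  have "continuous_on (cball x r) (\<lambda>y. f y * mollifier r (x - y))"
    by (intro continuous_intros continuous_on_subset[OF f] continuous_on_compose2[OF continuous_mollifier]) auto
  from borel_integrable_compact[OF compact_cball this]
  show ?thesis
  proof (rule Bochner_Integration.integrable_cong[THEN iffD1, rotated 2])
    show "indicat_real (cball x r) y *\<^sub>R (f y * mollifier r (x - y)) = f y * mollifier r (x - y)" for y
      using mollifier_eq_0[OF r, of "x - y"] by (cases "y \<in> cball x r") (auto simp: dist_norm)
  qed simp
qed

lemma integral_mollifier_pos:
  assumes r: "r > 0"
  shows "(\<integral>z. mollifier r z \<partial>(lborel :: 'a::euclidean_space measure)) > 0"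
proof -
  have int: "integrable lborel (mollifier r :: 'a \<Rightarrow> real)"
    using integrable_mollifier[of "\<lambda>_. 1" r 0] r by (simp add: mollifier_minus)
  let ?B = "ball (0::'a) (r/2)"
  have "0 < (r\<^sup>2 / 2)\<^sup>2 * measure lborel ?B"
    using r content_ball_pos[of "r/2" "0::'a"] by simp
  also have "\<dots> = (\<integral>z. (r\<^sup>2 / 2)\<^sup>2 * indicat_real ?B z \<partial>lborel)"
    using emeasure_lborel_ball_finite[of "0::'a" "r/2"] by simp
  also have "\<dots> \<le> (\<integral>z. mollifier r z \<partial>(lborel :: 'a measure))"
  proof (rule integral_mono[OF _ int])
    show "integrable lborel (\<lambda>z::'a. (r\<^sup>2 / 2)\<^sup>2 * indicat_real ?B z)"
      using emeasure_lborel_ball_finite[of "0::'a" "r/2"]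
      by (intro integrable_mult_right integrable_real_indicator) auto
    fix z :: 'a
    have "(r\<^sup>2 / 2)\<^sup>2 \<le> mollifier r z" if "norm z < r / 2"
    proof -
      have "z \<bullet> z \<le> (r/2)\<^sup>2"
        using power_mono[of "norm z" "r/2" 2] that by (simp add: power2_norm_eq_inner)
      also have "(r/2)\<^sup>2 \<le> r\<^sup>2 / 2" by (simp add: power_divide)
      finally have "r\<^sup>2 / 2 \<le> max 0 (r\<^sup>2 - z \<bullet> z)" by linarith
      then show ?thesis unfolding mollifier_def by (intro power_mono) auto
    qed
    then show "(r\<^sup>2 / 2)\<^sup>2 * indicat_real ?B z \<le> mollifier r z"
      by (cases "z \<in> ?B") (auto simp: mollifier_nonneg)
  qed
  finally show ?thesis .
qed

lemma differentiable_mollifier_convolution: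
  fixes f :: "'a::euclidean_space \<Rightarrow> real"
  assumes f: "continuous_on UNIV f" and r: "r > 0"
  shows "(\<lambda>x. \<integral>y. f y * mollifier r (x - y) \<partial>lborel) differentiable (at x0)"
proof -
  \<comment> \<open>The box contains the supports of \<open>\<lambda>y. mollifier r (x - y)\<close>
    for all \<open>x\<close> in the unit ball about \<open>x0\<close>, so the domain of integration
    can be fixed and Leibniz' rule applies.\<close>
  obtain a where a: "cball x0 (1 + r) \<subseteq> cbox (- a) a"
    using bounded_subset_cbox_symmetric[OF bounded_cball] by blast
  let ?U = "ball x0 1"
  define fx where "fx x t = (- 4 * f t * max 0 (r\<^sup>2 - (x - t) \<bullet> (x - t))) *\<^sub>R blinfun_inner_right (x - t)" for x t
  have sub: "y \<in> cbox (- a) a" if "x \<in> ?U" "norm (x - y) < r" for x y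
  proof -
    have "dist x0 y \<le> dist x0 x + dist x y" by (rule dist_triangle)
    then have "y \<in> cball x0 (1 + r)" using that by (auto simp: dist_norm)
    then show ?thesis using a by blast
  qed
  have eq: "(\<integral>y. f y * mollifier r (x - y) \<partial>lborel) = integral (cbox (- a) a) (\<lambda>y. f y * mollifier r (x - y))"
    if x: "x \<in> ?U" for x
  proof -
    have "(\<integral>y. f y * mollifier r (x - y) \<partial>lborel) = integral UNIV (\<lambda>y. f y * mollifier r (x - y))"
      using integral_lborel[OF integrable_mollifier[OF f r]] by simp
    also have "\<dots> = integral UNIV (\<lambda>y. if y \<in> cbox (- a) a then f y * mollifier r (x - y) else 0)"
      using sub[OF x] by (intro integral_cong) (auto intro!: mollifier_eq_0[OF r] simp: not_less[symmetric])
    also have "\<dots> = integral (cbox (- a) a) (\<lambda>y. f y * mollifier r (x - y))"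
      by (rule integral_restrict_UNIV)
    finally show ?thesis .
  qed
  have "((\<lambda>x. integral (cbox (- a) a) (\<lambda>y. f y * mollifier r (x - y))) has_derivative
          blinfun_apply (integral (cbox (- a) a) (fx x0))) (at x0 within ?U)"
  proof (rule leibniz_rule)
    fix x t
    have "((\<lambda>x. mollifier r (x - t)) has_derivative
        (\<lambda>v. - 4 * max 0 (r\<^sup>2 - (x - t) \<bullet> (x - t)) * ((x - t) \<bullet> v))) (at x within ?U)"
      by (rule has_derivative_compose[of "\<lambda>x. x - t" "\<lambda>v. v" x ?U, OF _ has_derivative_mollifier])
        (auto intro!: derivative_eq_intros)
    then have "((\<lambda>x. f t * mollifier r (x - t)) has_derivative
        (\<lambda>v. f t * (- 4 * max 0 (r\<^sup>2 - (x - t) \<bullet> (x - t)) * ((x - t) \<bullet> v)))) (at x within ?U)"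
      by (rule has_derivative_mult_right)
    moreover have "(\<lambda>v. f t * (- 4 * max 0 (r\<^sup>2 - (x - t) \<bullet> (x - t)) * ((x - t) \<bullet> v))) = blinfun_apply (fx x t)"
      by (rule ext) (simp add: fx_def blinfun.scaleR_left blinfun.minus_left)
    ultimately show "((\<lambda>x. f t * mollifier r (x - t)) has_derivative blinfun_apply (fx x t)) (at x within ?U)"
      by simp
  next
    fix x
    show "(\<lambda>y. f y * mollifier r (x - y)) integrable_on cbox (- a) a"
      by (intro integrable_continuous continuous_intros continuous_on_subset[OF f]
          continuous_on_compose2[OF continuous_mollifier]) auto
  next
    show "continuous_on (?U \<times> cbox (- a) a) (\<lambda>(x, t). fx x t)"
      unfolding fx_def case_prod_beta
      by (intro continuous_intros continuous_on_compose2[OF f]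
          bounded_linear.continuous_on[OF bounded_linear_blinfun_inner_right]) auto
  qed auto
  then have "((\<lambda>x. integral (cbox (- a) a) (\<lambda>y. f y * mollifier r (x - y))) has_derivative
          blinfun_apply (integral (cbox (- a) a) (fx x0))) (at x0)"
    by (simp add: at_within_open[of x0 ?U])
  then have "((\<lambda>x. \<integral>y. f y * mollifier r (x - y) \<partial>lborel) has_derivative
          blinfun_apply (integral (cbox (- a) a) (fx x0))) (at x0)"
    by (rule has_derivative_transform_within_open[of _ _ _ _ ?U]) (auto simp: eq)
  then show ?thesis by (auto simp: differentiable_def)
qed

lemma integral_lborel_translate:
  fixes h :: "'a::euclidean_space \<Rightarrow> real"
  assumes "h \<in> borel_measurable borel"
  shows "(\<integral>y. h y \<partial>lborel) = (\<integral>z. h (x + z) \<partial>lborel)"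
proof -
  have "(\<integral>y. h y \<partial>lborel) = (\<integral>y. h y \<partial>distr lborel borel ((+) x))"
    by (simp add: lborel_distr_plus)
  also have "\<dots> = (\<integral>z. h (x + z) \<partial>lborel)"
    by (rule integral_distr) (use assms in auto)
  finally show ?thesis .
qed

text \<open>An average inherits every increment bound that holds on the \<open>r\<close>-ball. The
  bounds are one-sided because the payoff behaves differently upward and downward; a lower bound is
  the upper bound for the reversed step.\<close>

lemma mollify:
  fixes f :: "'a::euclidean_space \<Rightarrow> real"
  assumes f: "continuous_on UNIV f" and r: "r > 0"
  shows "\<exists>g. (\<forall>x. g differentiable (at x)) \<and>
    (\<forall>x v c. (\<forall>y\<in>ball x r. f (y + v) - f y \<le> c) \<longrightarrow> g (x + v) - g x \<le> c) \<and>
    (\<forall>a b. (\<forall>y. a \<le> f y \<and> f y \<le> b) \<longrightarrow> (\<forall>x. a \<le> g x \<and> g x \<le> b))"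
proof -
  define C where "C = (\<integral>z. mollifier r z \<partial>(lborel :: 'a measure))"
  have C: "C > 0" unfolding C_def by (rule integral_mollifier_pos[OF r])
  have cont: "continuous_on UNIV (\<lambda>z. f (x + z))" for x
    by (intro continuous_on_compose2[OF f] continuous_intros) auto
  have int: "integrable lborel (\<lambda>z. h z * mollifier r z)" if "continuous_on UNIV h" for h :: "'a \<Rightarrow> real"
    using integrable_mollifier[OF that r, of 0] by (simp add: mollifier_minus)
  define g where "g x = (\<integral>y. f y * mollifier r (x - y) \<partial>lborel) / C" for x
  have g_eq: "g x = (\<integral>z. f (x + z) * mollifier r z \<partial>lborel) / C" for x
  proof -
    have "(\<lambda>y. f y * mollifier r (x - y)) \<in> borel_measurable borel"
      by (intro borel_measurable_continuous_onI continuous_intros f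
          continuous_on_compose2[OF continuous_mollifier]) auto
    from integral_lborel_translate[OF this, of x] show ?thesis
      by (simp add: g_def mollifier_minus)
  qed
  have avg_le: "(\<integral>z. h z * mollifier r z \<partial>lborel) / C \<le> c"
    if h: "continuous_on UNIV h" and le: "\<And>z. norm z < r \<Longrightarrow> h z \<le> c" for h :: "'a \<Rightarrow> real" and c
  proof -
    have "(\<integral>z. h z * mollifier r z \<partial>lborel) \<le> (\<integral>z. c * mollifier r z \<partial>(lborel :: 'a measure))"
    proof (rule integral_mono)
      show "integrable lborel (\<lambda>z. h z * mollifier r z)" by (rule int[OF h])
      show "integrable lborel (\<lambda>z::'a. c * mollifier r z)" by (rule int) (rule continuous_on_const)
      show "h z * mollifier r z \<le> c * mollifier r z" for z
        using le[of z] mollifier_eq_0[OF r, of z] mollifier_nonneg[of r z]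
        by (cases "norm z < r") (auto intro: mult_right_mono)
    qed
    also have "\<dots> = c * C" by (simp add: C_def)
    finally show ?thesis using C by (simp add: pos_divide_le_eq)
  qed
  have "g differentiable (at x)" for x
    unfolding g_def divide_inverse
    by (intro differentiable_mult differentiable_mollifier_convolution f r differentiable_const)
  moreover have "g (x + v) - g x \<le> c" if "\<forall>y\<in>ball x r. f (y + v) - f y \<le> c" for x v c
  proof -
    have "g (x + v) - g x = (\<integral>z. (f (x + v + z) - f (x + z)) * mollifier r z \<partial>lborel) / C"
      unfolding g_eq left_diff_distrib
      by (subst Bochner_Integration.integral_diff) (auto intro!: int cont simp: diff_divide_distrib)
    also have "\<dots> \<le> c"
    proof (rule avg_le)
      show "f (x + v + z) - f (x + z) \<le> c" if "norm z < r" for z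
        using bspec[OF \<open>\<forall>y\<in>ball x r. f (y + v) - f y \<le> c\<close>, of "x + z"] that
        by (simp add: dist_norm add.assoc add.commute[of v])
    qed (intro continuous_intros cont)
    finally show ?thesis .
  qed
  moreover have "a \<le> g x \<and> g x \<le> b" if ab: "\<forall>y. a \<le> f y \<and> f y \<le> b" for a b x
  proof
    show "g x \<le> b" unfolding g_eq by (rule avg_le[OF cont]) (use ab in auto)
    have "(\<integral>z. (- f (x + z)) * mollifier r z \<partial>lborel) / C \<le> - a"
      by (rule avg_le) (use ab in \<open>auto intro!: continuous_intros cont\<close>)
    then show "a \<le> g x" unfolding g_eq by simp
  qed
  ultimately show ?thesis by blast
qed

subsection \<open>Small functions with steep gradient\<close>

text \<open>Projection onto \<open>e\<close> is 1-Lipschitz and sends \<open>c t\<close> to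
  \<open>t\<close>, so a covering set is visited only within a time interval no longer than its
  diameter. Passing to the interval hulls \<open>J i\<close> supplies measurability.\<close>

lemma emeasure_le_hausdorff1:
  fixes c :: "real \<Rightarrow> 'a::real_inner"
  assumes e: "norm e = 1" and c: "\<And>t. c t \<bullet> e = t"
  shows "emeasure lborel {t. c t \<in> G} \<le> hausdorff1 (G \<inter> range c)"
proof -
  have "emeasure lborel {t. c t \<in> G} \<le> hausdorff1_pre 1 (G \<inter> range c)"
    unfolding hausdorff1_pre_def
  proof (rule Inf_greatest, clarify)
    fix C :: "nat \<Rightarrow> 'a set"
    assume cov: "G \<inter> range c \<subseteq> (\<Union>i. C i)" and C: "\<forall>i. bounded (C i) \<and> diameter (C i) \<le> 1"
    define J where "J i = (if {t. c t \<in> C i} = {} then {} else {Inf {t. c t \<in> C i}..Sup {t. c t \<in> C i}})" for i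
    have diam: "t - s \<le> diameter (C i)" if "c t \<in> C i" "c s \<in> C i" for i s t
    proof -
      have "t - s = (c t - c s) \<bullet> e" by (simp add: inner_diff_left c)
      also have "\<dots> \<le> dist (c t) (c s)"
        using norm_cauchy_schwarz[of "c t - c s" e] e by (simp add: dist_norm)
      also have "\<dots> \<le> diameter (C i)" using that C diameter_bounded_bound by blast
      finally show ?thesis .
    qed
    have bdd: "bdd_above {t. c t \<in> C i}" "bdd_below {t. c t \<in> C i}" for i
    proof -
      show "bdd_above {t. c t \<in> C i}"
      proof (cases "{t. c t \<in> C i} = {}")
        case False
        then obtain s where "c s \<in> C i" by auto
        then show ?thesis using diam[of _ i s] by (intro bdd_aboveI[of _ "s + diameter (C i)"]) force
      qed simp
      show "bdd_below {t. c t \<in> C i}"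
      proof (cases "{t. c t \<in> C i} = {}")
        case False
        then obtain s where "c s \<in> C i" by auto
        then show ?thesis using diam[of s i] by (intro bdd_belowI[of _ "s - diameter (C i)"]) force
      qed simp
    qed
    have J: "emeasure lborel (J i) \<le> ennreal (diameter (C i))" for i
    proof (cases "{t. c t \<in> C i} = {}")
      case False
      have "Sup {t. c t \<in> C i} - diameter (C i) \<le> s" if "c s \<in> C i" for s
      proof -
        have "Sup {t. c t \<in> C i} \<le> s + diameter (C i)"
          by (rule cSup_least[OF False]) (use diam[OF _ that] in force)
        then show ?thesis by simp
      qed
      then have "Sup {t. c t \<in> C i} - diameter (C i) \<le> Inf {t. c t \<in> C i}"
        by (intro cInf_greatest[OF False]) auto
      moreover have "Inf {t. c t \<in> C i} \<le> Sup {t. c t \<in> C i}"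
        by (rule cInf_le_cSup[OF False bdd])
      ultimately show ?thesis using False by (simp add: J_def ennreal_leI)
    qed (simp add: J_def)
    have "{t. c t \<in> G} \<subseteq> (\<Union>i. J i)"
    proof
      fix t assume "t \<in> {t. c t \<in> G}"
      then obtain i where i: "c t \<in> C i" using cov by blast
      then have "t \<in> J i" using bdd by (auto simp: J_def intro!: cInf_lower cSup_upper)
      then show "t \<in> (\<Union>i. J i)" by blast
    qed
    moreover have "J i \<in> sets lborel" for i by (simp add: J_def)
    ultimately have "emeasure lborel {t. c t \<in> G} \<le> emeasure lborel (\<Union>i. J i)"
      by (intro emeasure_mono) auto
    also have "\<dots> \<le> (\<Sum>i. emeasure lborel (J i))"
      by (rule emeasure_subadditive_countably) (auto simp: J_def)
    also have "\<dots> \<le> (\<Sum>i. ennreal (diameter (C i)))"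
      by (rule suminf_le) (use J in auto)
    finally show "emeasure lborel {t. c t \<in> G} \<le> (\<Sum>i. ennreal (diameter (C i)))" .
  qed
  also have "\<dots> \<le> hausdorff1 (G \<inter> range c)"
    unfolding hausdorff1_def by (rule SUP_upper) simp
  finally show ?thesis .
qed

lemma has_derivative_leI:
  fixes f :: "'a::real_normed_vector \<Rightarrow> real"
  assumes f: "(f has_derivative D) (at x)" and "d > 0"
    and le: "\<And>s. 0 < s \<Longrightarrow> s < d \<Longrightarrow> f (x + s *\<^sub>R v) - f x \<le> s * c"
  shows "D v \<le> c"
proof -
  interpret D: bounded_linear D using f by (rule has_derivative_bounded_linear)
  have "((\<lambda>s. f (x + s *\<^sub>R v)) has_derivative (\<lambda>s. D (s *\<^sub>R v))) (at 0)"
    by (rule has_derivative_compose[of "\<lambda>s. x + s *\<^sub>R v"]) (auto intro!: derivative_eq_intros f)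
  then have "((\<lambda>s. f (x + s *\<^sub>R v)) has_real_derivative D v) (at 0)"
    by (simp add: has_field_derivative_def D.scaleR mult_commute_abs)
  then have "((\<lambda>s. (f (x + s *\<^sub>R v) - f x) / s) \<longlongrightarrow> D v) (at 0)"
    by (simp add: DERIV_def)
  then have "((\<lambda>s. (f (x + s *\<^sub>R v) - f x) / s) \<longlongrightarrow> D v) (at_right 0)"
    by (rule tendsto_mono[OF at_le, rotated]) simp
  then show ?thesis
  proof (rule tendsto_upperbound)
    show "\<forall>\<^sub>F s in at_right 0. (f (x + s *\<^sub>R v) - f x) / s \<le> c"
      using eventually_at_right_less[of "0::real"] eventually_at_right_real[OF \<open>d > 0\<close>]
      by eventually_elim (use le in \<open>auto simp: pos_divide_le_eq mult.commute\<close>)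
  qed simp
qed

text \<open>The velocity is \<open>e + w\<close> with \<open>w\<close> orthogonal to
  \<open>e\<close> and \<open>norm w \<le> k\<close>: its component along \<open>e\<close> is 1 and
  its length at most \<open>sqrt (1 + k\<^sup>2)\<close>.\<close>

lemma steep_graph_in_cone_curves:
  fixes e :: "real^'n"
  assumes s: "s \<in> steep_graphs e k" and e: "norm e = 1" and k: "k \<ge> 0"
    and a: "a > 0" "a\<^sup>2 * (1 + k\<^sup>2) \<le> 1"
  shows "(\<lambda>t. t *\<^sub>R e + s t) \<in> cone_curves e a"
proof -
  have lip: "k-lipschitz_on UNIV s" and orth: "\<And>t. s t \<bullet> e = 0" using s by (auto simp: steep_graphs_def)
  obtain S where S: "finite S" "\<And>t. t \<notin> S \<Longrightarrow> s differentiable (at t)"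
    using s by (auto simp: steep_graphs_def)
  have "1-lipschitz_on UNIV (\<lambda>t. t *\<^sub>R e)"
    by (rule lipschitz_onI) (auto simp: dist_norm e simp flip: scaleR_diff_left)
  then have "(1 + k)-lipschitz_on UNIV (\<lambda>t. t *\<^sub>R e + s t)"
    by (intro lipschitz_on_add lip)
  moreover have "\<exists>v\<in>cone e a. ((\<lambda>t. t *\<^sub>R e + s t) has_vector_derivative v) (at t)" if t: "t \<notin> S" for t
  proof -
    obtain w where w: "(s has_vector_derivative w) (at t)"
      using S(2)[OF t] vector_derivative_works by blast
    have inner: "((\<lambda>t. s t \<bullet> u) has_derivative (\<lambda>h. h * (w \<bullet> u))) (at t)" for u
      using bounded_linear.has_derivative[OF bounded_linear_inner_left w[unfolded has_vector_derivative_def]]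
      by simp
    have "(\<lambda>h::real. h * (w \<bullet> e)) = (\<lambda>_. 0)"
      using inner[of e] has_derivative_const[of "0::real" "at t"]
      by (intro has_derivative_unique[of "\<lambda>t. s t \<bullet> e" _ t]) (simp_all add: orth)
    then have we: "w \<bullet> e = 0" by (metis mult_1)
    \<comment> \<open>The scalar function \<open>\<lambda>t. s t \<bullet> w\<close> has derivative
      \<open>w \<bullet> w\<close>, while the Lipschitz bound limits its growth to
      \<open>k * norm w\<close>.\<close>
    have "1 * (w \<bullet> w) \<le> k * norm w"
    proof (rule has_derivative_leI[OF inner, of 1])
      fix h :: real assume h: "0 < h"
      have "s (t + h *\<^sub>R 1) \<bullet> w - s t \<bullet> w = (s (t + h) - s t) \<bullet> w" by (simp add: inner_diff_left)
      also have "\<dots> \<le> norm (s (t + h) - s t) * norm w" by (rule norm_cauchy_schwarz)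
      also have "\<dots> \<le> (k * h) * norm w"
        using lipschitz_onD[OF lip, of "t + h" t] h by (intro mult_right_mono) (auto simp: dist_norm)
      finally show "s (t + h *\<^sub>R 1) \<bullet> w - s t \<bullet> w \<le> h * (k * norm w)" by (simp add: mult_ac)
    qed simp
    then have wk: "norm w \<le> k"
      using k by (cases "w = 0") (auto simp: power2_norm_eq_inner[symmetric] power2_eq_square)
    have "(norm (e + w))\<^sup>2 = 1 + (norm w)\<^sup>2"
      using e we by (simp add: power2_norm_eq_inner inner_add_left inner_add_right norm_eq_1 inner_commute)
    also have "\<dots> \<le> 1 + k\<^sup>2" using wk by (simp add: power_mono)
    finally have "a\<^sup>2 * (norm (e + w))\<^sup>2 \<le> 1"
      using a(2) mult_left_mono[of "(norm (e + w))\<^sup>2" "1 + k\<^sup>2" "a\<^sup>2"] by simp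
    then have "(a * norm (e + w))\<^sup>2 \<le> 1\<^sup>2" by (simp add: power_mult_distrib)
    then have "a * norm (e + w) \<le> 1" by (rule power2_le_imp_le) simp
    then have "e + w \<in> cone e a"
      using e we dot_square_norm[of e] by (simp add: cone_def inner_add_left)
    moreover have "((\<lambda>t. t *\<^sub>R e + s t) has_vector_derivative (e + w)) (at t)"
      by (rule derivative_eq_intros w refl | simp)+
    ultimately show ?thesis by blast
  qed
  moreover have "AE t in lebesgue. t \<notin> S"
    using negligible_finite[OF S(1)] by (intro AE_not_in) (simp add: negligible_iff_null_sets)
  ultimately show ?thesis
    unfolding cone_curves_def by (auto elim: eventually_mono)
qed

lemma norm_perp_le:
  assumes "norm e = 1"
  shows "norm (perp e v) \<le> norm v"
proof -
  have "(norm (perp e v))\<^sup>2 = (norm v)\<^sup>2 - (v \<bullet> e)\<^sup>2"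
    using assms unfolding power2_norm_eq_inner norm_eq_1
    by (simp add: perp_def inner_diff_left inner_diff_right inner_commute power2_eq_square)
  then have "(norm (perp e v))\<^sup>2 \<le> (norm v)\<^sup>2" by simp
  then show ?thesis by (rule power2_le_imp_le) simp
qed

text \<open>A mollified payoff of a neighbourhood with width below \<eta>. The upper bound on
  increments confines the gradient to the segment, and the lower bound along \<open>e\<close> near
  \<open>K\<close> forces it to the end \<open>e\<close>.\<close>

lemma small_function_with_steep_gradient:
  fixes K :: "(real^'n) set"
  assumes K: "compact K" and e: "norm e = 1" and eps: "0 < \<epsilon>" "\<epsilon> \<le> 1"
    and null: "width e (\<epsilon> / 2) K = 0" and eta: "\<eta> > 0"
  shows "\<exists>g D N. (\<forall>x. (g has_derivative D x) (at x)) \<and> (\<forall>x. 0 \<le> g x \<and> g x \<le> \<eta>) \<and>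
    (\<forall>x v. D x v \<le> max 0 (v \<bullet> e) + \<epsilon> * norm v) \<and> open N \<and> K \<subseteq> N \<and>
    (\<forall>x\<in>N. \<forall>v. \<bar>D x v - v \<bullet> e\<bar> \<le> \<epsilon> * norm v)"
proof -
  \<comment> \<open>The lateral price \<open>1 / k\<close> becomes \<epsilon>, and the graphs fit
    into the cone of aperture \<open>\<epsilon> / 2\<close> because \<open>(\<epsilon> / 2)\<^sup>2
    * (1 + k\<^sup>2) = (\<epsilon>\<^sup>2 + 1) / 4\<close>.\<close>
  define k where "k = 1 / \<epsilon>"
  have k: "k > 0" using eps by (simp add: k_def)
  have "e \<noteq> 0" using e by auto
  then have "(INF G\<in>{G. open G \<and> K \<subseteq> G}. width_open e (\<epsilon> / 2) G) < ennreal \<eta>"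
    using null eps eta by (simp add: width_def split: if_splits)
  then obtain G where G: "open G" "K \<subseteq> G" "width_open e (\<epsilon> / 2) G < ennreal \<eta>"
    by (auto simp: INF_less_iff)
  have short: "emeasure lborel {t. t *\<^sub>R e + s t \<in> G} \<le> ennreal \<eta>" if s: "s \<in> steep_graphs e k" for s
  proof -
    have "(\<epsilon> / 2)\<^sup>2 * (1 + k\<^sup>2) = (\<epsilon>\<^sup>2 + 1) / 4"
      using eps by (simp add: k_def power_divide field_simps)
    also have "\<dots> \<le> 1" using eps power_le_one[of \<epsilon> 2] by simp
    finally have "(\<lambda>t. t *\<^sub>R e + s t) \<in> cone_curves e (\<epsilon> / 2)"
      using eps k by (intro steep_graph_in_cone_curves[OF s e]) auto
    then have "hausdorff1 (G \<inter> range (\<lambda>t. t *\<^sub>R e + s t)) \<le> width_open e (\<epsilon> / 2) G"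
      unfolding width_open_def by (rule SUP_upper)
    moreover have "emeasure lborel {t. t *\<^sub>R e + s t \<in> G} \<le> hausdorff1 (G \<inter> range (\<lambda>t. t *\<^sub>R e + s t))"
      using s e by (intro emeasure_le_hausdorff1[OF e]) (auto simp: steep_graphs_def inner_add_left norm_eq_1)
    ultimately show ?thesis using G(3) by order
  qed
  define f where "f = payoff e k G"
  note payoff_facts = payoff_nonneg[OF e k G(1) short] payoff_le[OF e k G(1) short]
    payoff_increment_le[OF e k G(1) short] payoff_axis_ge[OF e k G(1) short]
  have f01: "0 \<le> f x \<and> f x \<le> \<eta>" for x
    using payoff_facts(1,2) eta by (simp add: f_def)
  have inc: "f (x + v) - f x \<le> max 0 (v \<bullet> e) + \<epsilon> * norm (perp e v)" for x v
    using payoff_facts(3)[of "x + v" x] eta by (simp add: f_def k_def mult.commute)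
  have "(1 + \<epsilon>)-lipschitz_on UNIV f"
  proof (rule lipschitz_onI)
    have *: "f y - f x \<le> (1 + \<epsilon>) * norm (y - x)" for x y
    proof -
      have "f y - f x \<le> max 0 ((y - x) \<bullet> e) + \<epsilon> * norm (perp e (y - x))" using inc[of x "y - x"] by simp
      also have "\<dots> \<le> norm (y - x) + \<epsilon> * norm (y - x)"
        using norm_cauchy_schwarz[of "y - x" e] e norm_perp_le[OF e, of "y - x"] eps
        by (intro add_mono mult_left_mono) auto
      finally show ?thesis by (simp add: algebra_simps)
    qed
    show "dist (f x) (f y) \<le> (1 + \<epsilon>) * dist x y" for x y
      using *[of x y] *[of y x] by (auto simp: dist_norm norm_minus_commute abs_le_iff)
  qed (use eps in simp)
  then have cont: "continuous_on UNIV f" by (rule lipschitz_on_continuous_on)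
  \<comment> \<open>One \<open>r\<close> for the distance of \<open>N\<close> from \<open>K\<close>,
    one for the mollification, one for the length of the step along \<open>e\<close>.\<close>
  obtain r where r: "r > 0" "(\<Union>x\<in>K. ball x (3 * r)) \<subseteq> G"
  proof -
    obtain d where "d > 0" "(\<Union>x\<in>K. ball x d) \<subseteq> G"
      using compact_subset_open_imp_ball_epsilon_subset[OF K G(1,2)] by blast
    then show thesis using that[of "d / 3"] by simp
  qed
  obtain g where g: "\<And>x. g differentiable (at x)"
    and g_inc: "\<And>x v c. (\<And>y. y\<in>ball x r \<Longrightarrow> f (y + v) - f y \<le> c) \<Longrightarrow> g (x + v) - g x \<le> c"
    and g_range: "\<And>a b. (\<And>y. a \<le> f y \<and> f y \<le> b) \<Longrightarrow> (\<forall>x. a \<le> g x \<and> g x \<le> b)"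
    using mollify[OF cont r(1)] by blast
  define D where "D x = frechet_derivative g (at x)" for x
  have D: "(g has_derivative D x) (at x)" for x
    using g by (simp add: D_def frechet_derivative_works[symmetric])
  have lin: "linear (D x)" for x using D has_derivative_linear by blast
  define N where "N = (\<Union>x\<in>K. ball x r)"
  have D_le: "D x v \<le> max 0 (v \<bullet> e) + \<epsilon> * norm (perp e v)" for x v
  proof (rule has_derivative_leI[OF D, of 1])
    fix s :: real assume "0 < s"
    have "perp e (s *\<^sub>R v) = s *\<^sub>R perp e v" by (simp add: perp_def scaleR_diff_right)
    then have "max 0 (s *\<^sub>R v \<bullet> e) + \<epsilon> * norm (perp e (s *\<^sub>R v)) = s * (max 0 (v \<bullet> e) + \<epsilon> * norm (perp e v))"
      using \<open>0 < s\<close> by (simp add: max_def algebra_simps zero_le_mult_iff)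
    then show "g (x + s *\<^sub>R v) - g x \<le> s * (max 0 (v \<bullet> e) + \<epsilon> * norm (perp e v))"
      using g_inc[of x "s *\<^sub>R v"] inc[of _ "s *\<^sub>R v"] by metis
  qed simp
  have D_axis: "D x e \<ge> 1" if x: "x \<in> N" for x
  proof -
    \<comment> \<open>Mollification transfers upper bounds only, so the gain along \<open>e\<close>
      is phrased as a loss along \<open>- e\<close>.\<close>
    have "- D x e \<le> - 1"
    proof (rule has_derivative_leI[OF has_derivative_minus[OF D] r(1)])
      fix s assume s: "0 < s" "s < r"
      obtain z where z: "z \<in> K" "dist z x < r" using x by (auto simp: N_def)
      have "g (x + s *\<^sub>R e + (- s *\<^sub>R e)) - g (x + s *\<^sub>R e) \<le> - s"
      proof (rule g_inc)
        fix y assume y: "y \<in> ball (x + s *\<^sub>R e) r"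
        define y' where "y' = y - s *\<^sub>R e"
        have y': "dist x y' < r" using y by (simp add: y'_def dist_norm algebra_simps)
        have "f (y' + s *\<^sub>R e) \<ge> f y' + s"
          unfolding f_def
        proof (rule payoff_facts(4))
          fix t assume t: "0 \<le> t" "t \<le> s"
          have "dist z (y' + t *\<^sub>R e) \<le> dist z x + dist x y' + dist y' (y' + t *\<^sub>R e)"
            by (meson add_right_mono dist_triangle order_trans)
          also have "\<dots> < 3 * r" using z y' t s e by (simp add: dist_norm)
          finally have "y' + t *\<^sub>R e \<in> ball z (3 * r)" by simp
          then show "y' + t *\<^sub>R e \<in> G" using r(2) z(1) by blast
        qed (use s eta in auto)
        then show "f (y + (- s *\<^sub>R e)) - f y \<le> - s" by (simp add: y'_def)
      qed
      then show "- g (x + s *\<^sub>R e) - - g x \<le> s * - 1" by simp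
    qed
    then show ?thesis by simp
  qed
  have D_near: "\<bar>D x v - v \<bullet> e\<bar> \<le> \<epsilon> * norm v" if x: "x \<in> N" for x v
  proof -
    have perp_e: "perp e e = 0" using e by (simp add: perp_def norm_eq_1)
    \<comment> \<open>Equality is exact, since the error term in \<open>D_le\<close> involves only
      \<open>perp e\<close> and vanishes at \<open>e\<close>. The deviation of \<open>D x\<close> is
      thus purely lateral.\<close>
    have De: "D x e = 1"
      using D_axis[OF x] D_le[of x e] e perp_e by (simp add: norm_eq_1)
    define w where "w = perp e v"
    have "w \<bullet> e = 0" using perp_inner[OF e, of v] by (simp add: w_def)
    then have w: "w \<bullet> e = 0" "perp e w = w" "perp e (- w) = - w" by (simp_all add: perp_def)
    have "D x v = D x ((v \<bullet> e) *\<^sub>R e + w)" using perp_decomp[of v e] by (simp add: w_def)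
    also have "\<dots> = v \<bullet> e + D x w"
      using De by (simp add: linear_add[OF lin] linear_scale[OF lin])
    finally have "D x v - v \<bullet> e = D x w" by simp
    moreover have "D x w \<le> \<epsilon> * norm w" "- D x w \<le> \<epsilon> * norm w"
      using D_le[of x w] D_le[of x "- w"] w by (auto simp: linear_neg[OF lin])
    moreover have "\<epsilon> * norm w \<le> \<epsilon> * norm v"
      using norm_perp_le[OF e] eps by (simp add: w_def)
    ultimately show ?thesis by linarith
  qed
  have "D x v \<le> max 0 (v \<bullet> e) + \<epsilon> * norm v" for x v
  proof -
    have "\<epsilon> * norm (perp e v) \<le> \<epsilon> * norm v" using norm_perp_le[OF e] eps by simp
    then show ?thesis using D_le[of x v] by linarith
  qed
  moreover have "open N" "K \<subseteq> N" using r by (auto simp: N_def)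
  ultimately show ?thesis
    using D D_near g_range[OF f01]
    by (intro exI[of _ g] exI[of _ D] exI[of _ N] conjI allI ballI) simp_all
qed

subsection \<open>Stages\<close>

text \<open>Pointwise and with the derivative hidden, so that at one point each summand of a series
  can have its own bound.\<close>

definition slope_le :: "('a::real_normed_vector \<Rightarrow> real) \<Rightarrow> 'a \<Rightarrow> real \<Rightarrow> bool" where
  "slope_le f x m \<longleftrightarrow> (\<exists>D. (f has_derivative D) (at x) \<and> (\<forall>v. \<bar>D v\<bar> \<le> m * norm v))"

lemma slope_leI: "(f has_derivative D) (at x) \<Longrightarrow> (\<And>v. \<bar>D v\<bar> \<le> m * norm v) \<Longrightarrow> slope_le f x m"
  by (auto simp: slope_le_def)

lemma slope_le_differentiable: "slope_le f x m \<Longrightarrow> f differentiable (at x)"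
  by (auto simp: slope_le_def differentiable_def)

lemma slope_le_mono: "slope_le f x m \<Longrightarrow> m \<le> m' \<Longrightarrow> slope_le f x m'"
  by (meson mult_right_mono norm_ge_zero order_trans slope_le_def)

lemma slope_le_add:
  assumes "slope_le f x a" "slope_le g x b"
  shows "slope_le (\<lambda>x. f x + g x) x (a + b)"
proof -
  obtain D D' where "(f has_derivative D) (at x)" "(g has_derivative D') (at x)"
    "\<And>v. \<bar>D v\<bar> \<le> a * norm v" "\<And>v. \<bar>D' v\<bar> \<le> b * norm v"
    using assms by (auto simp: slope_le_def)
  then show ?thesis
    by (intro slope_leI[OF has_derivative_add]) (auto simp: distrib_right intro: order_trans[OF abs_triangle_ineq] add_mono)
qed

lemma slope_le_const: "0 \<le> m \<Longrightarrow> slope_le (\<lambda>_. c) x m"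
  by (rule slope_leI[OF has_derivative_const]) simp

lemma slope_le_sum:
  assumes "\<And>i. i \<in> I \<Longrightarrow> slope_le (f i) x (m i)"
  shows "slope_le (\<lambda>x. \<Sum>i\<in>I. f i x) x (\<Sum>i\<in>I. m i)"
  using assms by (induction I rule: infinite_finite_induct) (auto intro: slope_le_add slope_le_const)

lemma slope_le_increment:
  fixes f :: "'a::{real_normed_vector,perfect_space} \<Rightarrow> real"
  assumes "convex S" "\<And>z. z \<in> S \<Longrightarrow> slope_le f z m" "x \<in> S" "y \<in> S"
  shows "\<bar>f y - f x\<bar> \<le> m * norm (y - x)"
proof -
  obtain D where D: "\<And>z. z \<in> S \<Longrightarrow> (f has_derivative D z) (at z)" "\<And>z v. z \<in> S \<Longrightarrow> \<bar>D z v\<bar> \<le> m * norm v"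
    using assms(2) unfolding slope_le_def by metis
  have "norm (f y - f x) \<le> m * norm (y - x)"
  proof (rule differentiable_bound[OF assms(1)])
    show "(f has_derivative D z) (at z within S)" if "z \<in> S" for z
      using D(1)[OF that] by (rule has_derivative_at_withinI)
    show "onorm (D z) \<le> m" if "z \<in> S" for z
      using D(2)[OF that] by (intro onorm_le) auto
  qed (use assms in auto)
  then show ?thesis by simp
qed

lemma infdist_nbhd:
  fixes K :: "'a::heine_borel set"
  assumes "compact K" "K \<noteq> {}" "open N" "K \<subseteq> N"
  obtains r where "r > 0" "\<And>x. infdist x K < r \<Longrightarrow> x \<in> N"
proof -
  obtain r where r: "r > 0" "(\<Union>x\<in>K. ball x r) \<subseteq> N"
    using compact_subset_open_imp_ball_epsilon_subset assms by metis
  have "x \<in> N" if "infdist x K < r" for x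
  proof -
    obtain y where "y \<in> K" "infdist x K = dist x y"
      using infdist_attains_inf[OF compact_imp_closed] assms by metis
    then have "x \<in> (\<Union>x\<in>K. ball x r)" using that by (auto simp: dist_commute)
    then show ?thesis using r by blast
  qed
  then show thesis using that r by blast
qed

text \<open>
  One increment of the series.  The next stage is built at a scale below \<open>r\<close>, so that its size is
  negligible against the oscillation of this one, and this one is flat where the next one acts.
\<close>

definition stage :: "'a::euclidean_space set \<Rightarrow> 'a set \<Rightarrow> 'a set \<Rightarrow> real \<Rightarrow> real \<Rightarrow> real \<Rightarrow> real \<Rightarrow> real \<Rightarrow> ('a \<Rightarrow> real) \<Rightarrow> bool" where
  "stage K X U M d c \<eta> r h \<longleftrightarrow>
     0 < r \<and> r \<le> \<eta> \<and> (\<forall>x. \<bar>h x\<bar> \<le> d * \<eta>) \<and> (\<forall>x. x \<notin> U \<longrightarrow> h x = 0) \<and>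
     (\<forall>x. slope_le h x M) \<and> (\<forall>x. infdist x K < r \<longrightarrow> slope_le h x d) \<and>
     (\<forall>x\<in>X. \<exists>v. r \<le> norm v \<and> norm v \<le> \<eta> \<and> \<bar>h (x + v) - h x\<bar> \<ge> c * norm v)"

section \<open>Superposition of stages at decreasing scales\<close>

lemma stage_mono:
  assumes "stage K X U M d c \<eta> r h" "M \<le> M'" "d \<le> d'" "c' \<le> c"
  shows "stage K X U M' d' c' \<eta> r h"
proof -
  have "d * \<eta> \<le> d' * \<eta>" using assms by (intro mult_right_mono) (auto simp: stage_def)
  then show ?thesis using assms unfolding stage_def
    by (meson mult_right_mono norm_ge_zero order_trans slope_le_mono)
qed

lemma slope_le_increment_infdist:
  fixes h :: "'a::euclidean_space \<Rightarrow> real"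
  assumes "x \<in> K" "norm v < r" "\<And>y. infdist y K < r \<Longrightarrow> slope_le h y d"
  shows "\<bar>h (x + v) - h x\<bar> \<le> d * norm v"
proof -
  have "slope_le h z d" if "z \<in> ball x r" for z
    using assms(3)[of z] infdist_le[OF assms(1), of z] that by (simp add: dist_commute)
  moreover have "r > 0" using assms(2) norm_ge_zero[of v] by linarith
  ultimately show ?thesis
    using slope_le_increment[of "ball x r" h d x "x + v"] assms(2) by (simp add: dist_norm)
qed

text \<open>The scales separate the two oscillations. Along a witness for \<open>h1\<close>, of
  length at least \<open>r1\<close>, \<open>h2\<close> changes by at most twice its sup bound
  \<open>d2 * (r1 / 2)\<close>; a witness for \<open>h2\<close> has length at most
  \<open>r1 / 2\<close> and stays where \<open>h1\<close> is flat. Each oscillation loses only the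
  flatness constant of the other.\<close>

lemma stage_combine:
  assumes 1: "stage K X1 U M1 d1 c1 \<eta> r1 h1" and 2: "stage K X2 U M2 d2 c2 (r1 / 2) r2 h2"
    and X: "X2 \<subseteq> K" and c: "c \<le> c1 - d2" "c \<le> c2 - d1" and d: "d2 \<ge> 0"
  shows "stage K (X1 \<union> X2) U (M1 + M2) (d1 + d2) c \<eta> r2 (\<lambda>x. h1 x + h2 x)"
proof -
  have r1: "0 < r1" "r1 \<le> \<eta>" and r2: "0 < r2" "r2 \<le> r1 / 2"
    using 1 2 by (auto simp: stage_def)
  have b1: "\<bar>h1 x\<bar> \<le> d1 * \<eta>" and b2: "\<bar>h2 x\<bar> \<le> d2 * (r1 / 2)" for x
    using 1 2 by (auto simp: stage_def)
  have "d2 * (r1 / 2) \<le> d2 * \<eta>" using r1 d by (intro mult_left_mono) auto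
  then have "\<bar>h1 x + h2 x\<bar> \<le> (d1 + d2) * \<eta>" for x
    using b1[of x] b2[of x] by (simp add: distrib_right)
  moreover have "slope_le (\<lambda>x. h1 x + h2 x) x (M1 + M2)" for x
    using 1 2 by (intro slope_le_add) (auto simp: stage_def)
  moreover have "slope_le (\<lambda>x. h1 x + h2 x) x (d1 + d2)" if "infdist x K < r2" for x
    using 1 2 that r2 r1 by (intro slope_le_add) (auto simp: stage_def)
  moreover have "\<exists>v. r2 \<le> norm v \<and> norm v \<le> \<eta> \<and> \<bar>(h1 (x + v) + h2 (x + v)) - (h1 x + h2 x)\<bar> \<ge> c * norm v"
    if x: "x \<in> X1 \<union> X2" for x
    using x
  proof
    assume "x \<in> X1"
    then obtain v where v: "r1 \<le> norm v" "norm v \<le> \<eta>" "\<bar>h1 (x + v) - h1 x\<bar> \<ge> c1 * norm v"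
      using 1 by (auto simp: stage_def)
    have "\<bar>h2 (x + v) - h2 x\<bar> \<le> d2 * r1"
      using b2[of x] b2[of "x + v"] by simp
    also have "\<dots> \<le> d2 * norm v" using v d by (intro mult_left_mono) auto
    finally have "\<bar>(h1 (x + v) + h2 (x + v)) - (h1 x + h2 x)\<bar> \<ge> (c1 - d2) * norm v"
      using v(3) by (simp add: left_diff_distrib)
    moreover have "(c1 - d2) * norm v \<ge> c * norm v" using c by (intro mult_right_mono) auto
    ultimately show ?thesis using v r1 r2 by (intro exI[of _ v]) auto
  next
    assume x: "x \<in> X2"
    then obtain v where v: "r2 \<le> norm v" "norm v \<le> r1 / 2" "\<bar>h2 (x + v) - h2 x\<bar> \<ge> c2 * norm v"
      using 2 by (auto simp: stage_def)
    have "\<bar>h1 (x + v) - h1 x\<bar> \<le> d1 * norm v"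
      by (rule slope_le_increment_infdist[of x K v r1]) (use 1 v r1 x X in \<open>auto simp: stage_def\<close>)
    then have "\<bar>(h1 (x + v) + h2 (x + v)) - (h1 x + h2 x)\<bar> \<ge> (c2 - d1) * norm v"
      using v(3) by (simp add: left_diff_distrib)
    moreover have "(c2 - d1) * norm v \<ge> c * norm v" using c by (intro mult_right_mono) auto
    ultimately show ?thesis using v r1 r2 by (intro exI[of _ v]) auto
  qed
  ultimately show ?thesis
    using 1 2 r1 r2 by (simp add: stage_def)
qed

text \<open>The loss in oscillation is a multiple of \<open>d\<close>, which can be made small while
  \<open>c\<close> is essentially fixed. The index set will be \<open>Basis\<close>.\<close>

lemma stage_family_union:
  fixes X :: "'i \<Rightarrow> 'a::euclidean_space set"
  assumes "finite A" and X: "\<And>a. a \<in> A \<Longrightarrow> X a \<subseteq> K"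
    and ex: "\<And>a \<eta>. a \<in> A \<Longrightarrow> \<eta> > 0 \<Longrightarrow> \<exists>h r. stage K (X a) U M d c \<eta> r h"
    and d: "d \<ge> 0" and \<eta>: "\<eta> > 0"
  shows "\<exists>h r. stage K (\<Union>a\<in>A. X a) U (real (card A) * M) (real (card A) * d) (c - real (card A) * d) \<eta> r h"
  using assms(1) X ex
proof (induction A)
  case empty
  show ?case
    using \<eta> by (intro exI[of _ "\<lambda>_. 0"] exI[of _ \<eta>]) (auto simp: stage_def slope_le_const)
next
  case (insert a A)
  then obtain h1 r1 where 1: "stage K (\<Union>a\<in>A. X a) U (real (card A) * M) (real (card A) * d) (c - real (card A) * d) \<eta> r1 h1"
    by blast
  then have "r1 / 2 > 0" by (simp add: stage_def)
  then obtain h2 r2 where 2: "stage K (X a) U M d c (r1 / 2) r2 h2"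
    using insert.prems(2) by blast
  have "stage K ((\<Union>a\<in>A. X a) \<union> X a) U (real (card A) * M + M) (real (card A) * d + d) (c - real (card (insert a A)) * d) \<eta> r2
      (\<lambda>x. h1 x + h2 x)"
    by (rule stage_combine[OF 1 2]) (use insert d in \<open>auto simp: algebra_simps\<close>)
  moreover have "real (card A) * M + M = real (card (insert a A)) * M"
    "real (card A) * d + d = real (card (insert a A)) * d" "(\<Union>a\<in>A. X a) \<union> X a = (\<Union>a\<in>insert a A. X a)"
    using insert by (auto simp: algebra_simps)
  ultimately show ?case by metis
qed

text \<open>In the derivative of \<open>\<phi> i * g i\<close> the term with
  \<open>\<phi>' i\<close> is negligible because \<open>g i\<close> is uniformly small, so the
  gradient is essentially a weighted, signed combination of those of the \<open>g i\<close>.\<close>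

lemma partitioned_layer:
  fixes K :: "(real^'n) set" and C :: "'i \<Rightarrow> (real^'n) set"
  assumes K: "compact K" and J: "finite J" and eps: "0 < \<epsilon>" "\<epsilon> \<le> 1" and eta: "\<eta> > 0"
    and C: "\<And>i. i \<in> J \<Longrightarrow> closed (C i)" and e: "\<And>i. i \<in> J \<Longrightarrow> norm (e i) = 1"
    and null: "\<And>i. i \<in> J \<Longrightarrow> width (e i) (\<epsilon> / 2) (K \<inter> C i) = 0"
    and \<phi>: "\<And>i x. i \<in> J \<Longrightarrow> (\<phi> i has_derivative \<phi>' i x) (at x)"
    and \<phi>': "\<And>i x v. i \<in> J \<Longrightarrow> \<bar>\<phi>' i x v\<bar> \<le> L * norm v" and L: "L \<ge> 0"
    and \<phi>0: "\<And>i x. i \<in> J \<Longrightarrow> \<phi> i x \<ge> 0" and \<phi>1: "\<And>x. (\<Sum>i\<in>J. \<phi> i x) \<le> 1"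
    and off: "\<And>i x. i \<in> J \<Longrightarrow> x \<notin> C i \<Longrightarrow> \<phi> i x = 0"
    and s: "\<And>i. i \<in> J \<Longrightarrow> \<bar>s i\<bar> = 1"
  shows "\<exists>u u' N. (\<forall>x. (u has_derivative u' x) (at x)) \<and> (\<forall>x. \<bar>u x\<bar> \<le> \<eta>) \<and>
     (\<forall>x. (\<forall>i\<in>J. x \<notin> C i) \<longrightarrow> u x = 0) \<and> (\<forall>x v. \<bar>u' x v\<bar> \<le> 3 * norm v) \<and>
     open N \<and> K \<subseteq> N \<and>
     (\<forall>x\<in>N. \<forall>v. \<bar>u' x v - (\<Sum>i\<in>J. s i * \<phi> i x * (v \<bullet> e i))\<bar> \<le> 2 * \<epsilon> * norm v)"
proof -
  \<comment> \<open>Chosen so that the terms with \<open>\<phi>'\<close> sum to at most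
    \<open>\<epsilon> * norm v\<close>; the \<open>+ 1\<close> keeps the denominator
    positive.\<close>
  define \<eta>1 where "\<eta>1 = min \<eta> (\<epsilon> / (real (card J) * L + 1))"
  have den: "real (card J) * L + 1 > 0" using L by (simp add: add_nonneg_pos)
  have \<eta>1: "\<eta>1 > 0" "\<eta>1 \<le> \<eta>" "real (card J) * L * \<eta>1 \<le> \<epsilon>"
  proof -
    show "\<eta>1 > 0" "\<eta>1 \<le> \<eta>" using eta eps den by (auto simp: \<eta>1_def)
    have "real (card J) * L * \<eta>1 \<le> (real (card J) * L + 1) * (\<epsilon> / (real (card J) * L + 1))"
      using L \<open>\<eta>1 > 0\<close> by (intro mult_mono) (auto simp: \<eta>1_def)
    then show "real (card J) * L * \<eta>1 \<le> \<epsilon>" using den by simp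
  qed
  define Q where "Q i g D N \<longleftrightarrow> (\<forall>x. (g has_derivative D x) (at x)) \<and> (\<forall>x. 0 \<le> g x \<and> g x \<le> \<eta>1) \<and>
    (\<forall>x v. D x v \<le> max 0 (v \<bullet> e i) + \<epsilon> * norm v) \<and> open N \<and> K \<inter> C i \<subseteq> N \<and>
    (\<forall>x\<in>N. \<forall>v. \<bar>D x v - v \<bullet> e i\<bar> \<le> \<epsilon> * norm v)" for i g D N
  have "\<forall>i\<in>J. \<exists>g D N. Q i g D N"
    unfolding Q_def
    using small_function_with_steep_gradient[OF compact_Int_closed[OF K C] e eps null \<eta>1(1)] by (intro ballI)
  then obtain g D N where Q: "\<And>i. i \<in> J \<Longrightarrow> Q i (g i) (D i) (N i)" by metis
  have g: "\<And>i x. i \<in> J \<Longrightarrow> (g i has_derivative D i x) (at x)"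
    and g01: "\<And>i x. i \<in> J \<Longrightarrow> 0 \<le> g i x \<and> g i x \<le> \<eta>1"
    and D: "\<And>i x v. i \<in> J \<Longrightarrow> D i x v \<le> max 0 (v \<bullet> e i) + \<epsilon> * norm v"
    and N: "\<And>i. i \<in> J \<Longrightarrow> open (N i)" "\<And>i. i \<in> J \<Longrightarrow> K \<inter> C i \<subseteq> N i"
    and near: "\<And>i x v. i \<in> J \<Longrightarrow> x \<in> N i \<Longrightarrow> \<bar>D i x v - v \<bullet> e i\<bar> \<le> \<epsilon> * norm v"
    using Q unfolding Q_def by simp_all
  have D2: "\<bar>D i x v\<bar> \<le> 2 * norm v" if i: "i \<in> J" for i x v
  proof -
    have lin: "linear (D i x)" using g[OF i] has_derivative_linear by blast
    have "D i x w \<le> 2 * norm w" for w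
    proof -
      have "w \<bullet> e i \<le> norm w" using norm_cauchy_schwarz[of w "e i"] e[OF i] by simp
      moreover have "\<epsilon> * norm w \<le> norm w" using eps by (simp add: mult_left_le_one_le)
      ultimately have "max 0 (w \<bullet> e i) + \<epsilon> * norm w \<le> 2 * norm w"
        using norm_ge_zero[of w] by linarith
      then show ?thesis using D[OF i, of x w] by linarith
    qed
    from this[of v] this[of "- v"] show ?thesis by (simp add: linear_neg[OF lin])
  qed
  define u where "u x = (\<Sum>i\<in>J. s i * (\<phi> i x * g i x))" for x
  define u' where "u' x v = (\<Sum>i\<in>J. s i * (\<phi> i x * D i x v + \<phi>' i x v * g i x))" for x v
  have "(u has_derivative u' x) (at x)" for x
    unfolding u_def u'_def
    by (intro has_derivative_sum has_derivative_mult_right has_derivative_mult \<phi> g)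
  moreover have "\<bar>u x\<bar> \<le> \<eta>" for x
  proof -
    have "\<bar>u x\<bar> \<le> (\<Sum>i\<in>J. \<bar>s i * (\<phi> i x * g i x)\<bar>)" unfolding u_def by (rule sum_abs)
    also have "\<dots> \<le> (\<Sum>i\<in>J. \<phi> i x * \<eta>1)"
      using s g01 \<phi>0 by (intro sum_mono) (auto simp: abs_mult intro!: mult_left_mono)
    also have "\<dots> \<le> 1 * \<eta>1"
      unfolding sum_distrib_right[symmetric] using \<phi>1 \<eta>1 by (intro mult_right_mono) auto
    finally show ?thesis using \<eta>1 by simp
  qed
  moreover have "u x = 0" if "\<forall>i\<in>J. x \<notin> C i" for x
    using that off by (simp add: u_def)
  moreover have small: "(\<Sum>i\<in>J. \<bar>\<phi>' i x v * g i x\<bar>) \<le> \<epsilon> * norm v" for x v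
  proof -
    have "(\<Sum>i\<in>J. \<bar>\<phi>' i x v * g i x\<bar>) \<le> (\<Sum>i\<in>J. (L * norm v) * \<eta>1)"
      using \<phi>' g01 L by (intro sum_mono) (auto simp: abs_mult intro!: mult_mono)
    also have "\<dots> = (real (card J) * L * \<eta>1) * norm v" by simp
    also have "\<dots> \<le> \<epsilon> * norm v" using \<eta>1 by (intro mult_right_mono) auto
    finally show ?thesis .
  qed
  moreover have "\<bar>u' x v\<bar> \<le> 3 * norm v" for x v
  proof -
    have "\<bar>u' x v\<bar> \<le> (\<Sum>i\<in>J. \<bar>s i * (\<phi> i x * D i x v + \<phi>' i x v * g i x)\<bar>)"
      unfolding u'_def by (rule sum_abs)
    also have "\<dots> \<le> (\<Sum>i\<in>J. \<phi> i x * (2 * norm v) + \<bar>\<phi>' i x v * g i x\<bar>)"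
    proof (rule sum_mono)
      fix i assume i: "i \<in> J"
      have "\<bar>\<phi> i x * D i x v\<bar> \<le> \<phi> i x * (2 * norm v)"
        using D2[OF i] \<phi>0[OF i] by (simp add: abs_mult mult_left_mono)
      then show "\<bar>s i * (\<phi> i x * D i x v + \<phi>' i x v * g i x)\<bar> \<le> \<phi> i x * (2 * norm v) + \<bar>\<phi>' i x v * g i x\<bar>"
        unfolding abs_mult[of "s i"] s[OF i] mult_1 by linarith
    qed
    also have "\<dots> = (\<Sum>i\<in>J. \<phi> i x) * (2 * norm v) + (\<Sum>i\<in>J. \<bar>\<phi>' i x v * g i x\<bar>)"
      by (simp add: sum.distrib sum_distrib_right)
    also have "\<dots> \<le> 1 * (2 * norm v) + \<epsilon> * norm v"
      by (intro add_mono mult_right_mono \<phi>1 small) auto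
    also have "\<dots> \<le> 3 * norm v" using eps mult_right_mono[of \<epsilon> 1 "norm v"] by simp
    finally show ?thesis .
  qed
  \<comment> \<open>\<open>N i\<close> surrounds only \<open>K \<inter> C i\<close>; off
    \<open>C i\<close> the factor \<open>\<phi> i\<close> vanishes, and \<open>- C i\<close> is
    open.\<close>
  moreover define M where "M = (\<Inter>i\<in>J. N i \<union> - C i)"
  moreover have "open M" unfolding M_def using J N C by (intro open_INT ballI open_Un) auto
  moreover have "K \<subseteq> M" using N by (auto simp: M_def)
  moreover have "\<bar>u' x v - (\<Sum>i\<in>J. s i * \<phi> i x * (v \<bullet> e i))\<bar> \<le> 2 * \<epsilon> * norm v" if x: "x \<in> M" for x v
  proof -
    have "u' x v - (\<Sum>i\<in>J. s i * \<phi> i x * (v \<bullet> e i)) =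
        (\<Sum>i\<in>J. s i * (\<phi> i x * (D i x v - v \<bullet> e i) + \<phi>' i x v * g i x))"
      unfolding u'_def sum_subtractf[symmetric] by (intro sum.cong) (auto simp: algebra_simps)
    also have "\<bar>\<dots>\<bar> \<le> (\<Sum>i\<in>J. \<bar>s i * (\<phi> i x * (D i x v - v \<bullet> e i) + \<phi>' i x v * g i x)\<bar>)"
      by (rule sum_abs)
    also have "\<dots> \<le> (\<Sum>i\<in>J. \<phi> i x * (\<epsilon> * norm v) + \<bar>\<phi>' i x v * g i x\<bar>)"
    proof (rule sum_mono)
      fix i assume i: "i \<in> J"
      have "\<bar>\<phi> i x * (D i x v - v \<bullet> e i)\<bar> \<le> \<phi> i x * (\<epsilon> * norm v)"
      proof (cases "x \<in> C i")
        case True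
        then have "x \<in> N i" using x i by (auto simp: M_def)
        then show ?thesis using near[OF i] \<phi>0[OF i] by (simp add: abs_mult mult_left_mono)
      qed (simp add: off[OF i])
      then show "\<bar>s i * (\<phi> i x * (D i x v - v \<bullet> e i) + \<phi>' i x v * g i x)\<bar> \<le> \<phi> i x * (\<epsilon> * norm v) + \<bar>\<phi>' i x v * g i x\<bar>"
        unfolding abs_mult[of "s i"] s[OF i] mult_1 by linarith
    qed
    also have "\<dots> = (\<Sum>i\<in>J. \<phi> i x) * (\<epsilon> * norm v) + (\<Sum>i\<in>J. \<bar>\<phi>' i x v * g i x\<bar>)"
      by (simp add: sum.distrib sum_distrib_right)
    also have "\<dots> \<le> 1 * (\<epsilon> * norm v) + \<epsilon> * norm v"
      using eps by (intro add_mono mult_right_mono \<phi>1 small) auto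
    finally show ?thesis by simp
  qed
  ultimately show ?thesis
    by (intro exI[of _ u] exI[of _ u'] exI[of _ M] conjI allI ballI impI) simp_all
qed

text \<open>
  Mixing different directions \<open>e i\<close> could make the gradients cancel, so only those \<open>i\<close> are used for
  which \<open>e i\<close> has a large component along \<open>a\<close>, with signs making these components positive.  A second,
  much smaller layer then undoes the gradient of the first one close to \<open>K\<close>.
\<close>

lemma one_direction_stage:
  fixes K :: "(real^'n) set" and C :: "'i \<Rightarrow> (real^'n) set"
  assumes K: "compact K" "K \<noteq> {}" and I: "finite I" and eps: "0 < \<epsilon>" "\<epsilon> \<le> 1" and eta: "\<eta> > 0"
    and C: "\<And>i. i \<in> I \<Longrightarrow> closed (C i)" "\<And>i. i \<in> I \<Longrightarrow> C i \<subseteq> U" and e: "\<And>i. i \<in> I \<Longrightarrow> norm (e i) = 1"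
    and null: "\<And>i. i \<in> I \<Longrightarrow> width (e i) (\<epsilon> / 2) (K \<inter> C i) = 0"
    and \<phi>: "\<And>i x. i \<in> I \<Longrightarrow> (\<phi> i has_derivative \<phi>' i x) (at x)"
    and \<phi>': "\<And>i x v. i \<in> I \<Longrightarrow> \<bar>\<phi>' i x v\<bar> \<le> L * norm v" and L: "L \<ge> 0"
    and \<phi>0: "\<And>i x. i \<in> I \<Longrightarrow> \<phi> i x \<ge> 0" and \<phi>1: "\<And>x. (\<Sum>i\<in>I. \<phi> i x) \<le> 1"
    and off: "\<And>i x. i \<in> I \<Longrightarrow> x \<notin> C i \<Longrightarrow> \<phi> i x = 0"
    and a: "norm a = 1" and b: "0 < b"
  defines "J \<equiv> {i\<in>I. \<bar>e i \<bullet> a\<bar> \<ge> b}"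
  shows "\<exists>h r. stage K {x\<in>K. (\<Sum>i\<in>J. \<phi> i x) \<ge> b / 3} U 6 (4 * \<epsilon>) (b\<^sup>2 / 4 - 3 * \<epsilon>) \<eta> r h"
proof -
  have J: "finite J" "J \<subseteq> I" using I by (auto simp: J_def)
  define s where "s i = sgn (e i \<bullet> a)" for i
  have s: "\<bar>s i\<bar> = 1" "s i * (a \<bullet> e i) \<ge> b" if "i \<in> J" for i
  proof -
    have "\<bar>a \<bullet> e i\<bar> \<ge> b" using that by (simp add: J_def inner_commute)
    then show "\<bar>s i\<bar> = 1" "s i * (a \<bullet> e i) \<ge> b"
      using b by (auto simp: s_def inner_commute sgn_real_def abs_if split: if_splits)
  qed
  define P where "P x = (\<Sum>i\<in>J. \<phi> i x)" for x
  have P1: "P x \<le> 1" for x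
    using sum_mono2[OF I J(2), of "\<lambda>i. \<phi> i x"] \<phi>0 \<phi>1[of x] by (auto simp: P_def)
  define Q where "Q \<eta> u u' N \<longleftrightarrow> (\<forall>x. (u has_derivative u' x) (at x)) \<and> (\<forall>x. \<bar>u x\<bar> \<le> \<eta>) \<and>
     (\<forall>x. (\<forall>i\<in>J. x \<notin> C i) \<longrightarrow> u x = 0) \<and> (\<forall>x v. \<bar>u' x v\<bar> \<le> 3 * norm v) \<and>
     open N \<and> K \<subseteq> N \<and>
     (\<forall>x\<in>N. \<forall>v. \<bar>u' x v - (\<Sum>i\<in>J. s i * \<phi> i x * (v \<bullet> e i))\<bar> \<le> 2 * \<epsilon> * norm v)" for \<eta> u u' N
  have layers: "\<exists>u u' N. Q \<eta> u u' N" if "\<eta> > 0" for \<eta>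
    unfolding Q_def
    by (rule partitioned_layer[OF K(1) J(1) eps that, of C e \<phi> \<phi>' L s])
      (use C e null \<phi> \<phi>' L \<phi>0 P1 off s J(2) in \<open>auto simp: P_def subset_iff\<close>)
  \<comment> \<open>Two layers of size at most \<open>2 * \<epsilon> * \<eta>\<close> give the sup
    bound that a stage with flatness \<open>4 * \<epsilon>\<close> requires.\<close>
  obtain u u' N where Qu: "Q (2 * \<epsilon> * \<eta>) u u' N"
    using layers[of "2 * \<epsilon> * \<eta>"] eps eta by auto
  have u: "\<And>x. (u has_derivative u' x) (at x)" "\<And>x. \<bar>u x\<bar> \<le> 2 * \<epsilon> * \<eta>"
    "\<And>x. (\<forall>i\<in>J. x \<notin> C i) \<Longrightarrow> u x = 0" "\<And>x v. \<bar>u' x v\<bar> \<le> 3 * norm v"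
    and N: "open N" "K \<subseteq> N"
    and near: "\<And>x v. x\<in>N \<Longrightarrow> \<bar>u' x v - (\<Sum>i\<in>J. s i * \<phi> i x * (v \<bullet> e i))\<bar> \<le> 2 * \<epsilon> * norm v"
    using Qu unfolding Q_def by simp_all
  obtain r1 where r1: "r1 > 0" "\<And>x. infdist x K < r1 \<Longrightarrow> x \<in> N"
    using infdist_nbhd[OF K N] by blast
  define B where "B = real (card J) * L"
  have B: "B \<ge> 0" using L by (simp add: B_def)
  \<comment> \<open>The step stays where the gradient of \<open>u\<close> is controlled, and
    \<open>B * t \<le> b / 12\<close> lets \<open>P\<close> fall from \<open>b / 3\<close> to no
    less than \<open>b / 4\<close> along it.\<close>
  define t where "t = min (min \<eta> (r1 / 2)) (b / (12 * (B + 1)))"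
  have t: "t > 0" "t \<le> \<eta>" "t < r1" "B * t \<le> b / 12"
  proof -
    have "b / (12 * (B + 1)) > 0" using b B by simp
    then show "t > 0" using eta r1(1) by (simp add: t_def)
    have "t \<le> r1 / 2" unfolding t_def by linarith
    then show "t < r1" using r1(1) by linarith
    show "t \<le> \<eta>" unfolding t_def by linarith
    have "B * t \<le> (B + 1) * (b / (12 * (B + 1)))"
      using B \<open>t > 0\<close> by (intro mult_mono) (auto simp: t_def)
    also have "\<dots> = b / 12" using B by (simp add: field_simps)
    finally show "B * t \<le> b / 12" .
  qed
  have P_lip: "\<bar>P y - P x\<bar> \<le> B * norm (y - x)" for x y
  proof (rule slope_le_increment[of UNIV])
    show "slope_le P z B" for z
    proof (rule slope_leI)
      show "(P has_derivative (\<lambda>v. \<Sum>i\<in>J. \<phi>' i z v)) (at z)"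
        unfolding P_def using J by (intro has_derivative_sum \<phi>) auto
      fix v
      have "\<bar>\<Sum>i\<in>J. \<phi>' i z v\<bar> \<le> (\<Sum>i\<in>J. L * norm v)"
        by (rule order_trans[OF sum_abs sum_mono]) (use \<phi>' J in auto)
      then show "\<bar>\<Sum>i\<in>J. \<phi>' i z v\<bar> \<le> B * norm v" by (simp add: B_def)
    qed
  qed auto
  \<comment> \<open>Small against \<open>t\<close>: over the step the second layer changes by at
    most \<open>\<epsilon> * t\<close>.\<close>
  define w where "w = min (2 * \<epsilon> * \<eta>) (\<epsilon> * t / 2)"
  have w: "w > 0" "w \<le> 2 * \<epsilon> * \<eta>" "w \<le> \<epsilon> * t / 2" using eps eta t by (auto simp: w_def)
  obtain z z' N' where Qz: "Q w z z' N'"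
    using layers[OF w(1)] by auto
  have z: "\<And>x. (z has_derivative z' x) (at x)" "\<And>x. \<bar>z x\<bar> \<le> w"
    "\<And>x. (\<forall>i\<in>J. x \<notin> C i) \<Longrightarrow> z x = 0" "\<And>x v. \<bar>z' x v\<bar> \<le> 3 * norm v"
    and N': "open N'" "K \<subseteq> N'"
    and near': "\<And>x v. x\<in>N' \<Longrightarrow> \<bar>z' x v - (\<Sum>i\<in>J. s i * \<phi> i x * (v \<bullet> e i))\<bar> \<le> 2 * \<epsilon> * norm v"
    using Qz unfolding Q_def by simp_all
  have "open (N \<inter> N')" "K \<subseteq> N \<inter> N'" using N N' by auto
  from infdist_nbhd[OF K this] obtain r2 where r2: "r2 > 0" "\<And>x. infdist x K < r2 \<Longrightarrow> x \<in> N \<inter> N'"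
    by metis
  define r where "r = min r2 t"
  have r: "r > 0" "r \<le> t" "r \<le> r2" using r2 t by (auto simp: r_def)
  define h where "h x = u x - z x" for x
  have h': "(h has_derivative (\<lambda>v. u' x v - z' x v)) (at x)" for x
    unfolding h_def by (intro has_derivative_diff u z)
  have "slope_le h x 6" for x
  proof (rule slope_leI[OF h'])
    show "\<bar>u' x v - z' x v\<bar> \<le> 6 * norm v" for v using u(4)[of x v] z(4)[of x v] by linarith
  qed
  \<comment> \<open>Both layers have gradient within \<open>2 * \<epsilon>\<close> of the same
    signed sum, which cancels in the difference.\<close>
  moreover have "slope_le h x (4 * \<epsilon>)" if "infdist x K < r" for x
  proof (rule slope_leI[OF h'])
    have "x \<in> N" "x \<in> N'" using r2(2)[of x] r that by auto
    then show "\<bar>u' x v - z' x v\<bar> \<le> 4 * \<epsilon> * norm v" for v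
      using near[of x v] near'[of x v] by linarith
  qed
  moreover have "\<bar>h x\<bar> \<le> 4 * \<epsilon> * \<eta>" for x
    using u(2)[of x] z(2)[of x] w by (simp add: h_def)
  moreover have "h x = 0" if "x \<notin> U" for x
  proof -
    have "\<forall>i\<in>J. x \<notin> C i" using C(2) J(2) that by blast
    then show ?thesis using u(3) z(3) by (simp add: h_def)
  qed
  moreover have "\<exists>v. r \<le> norm v \<and> norm v \<le> \<eta> \<and> \<bar>h (x + v) - h x\<bar> \<ge> (b\<^sup>2 / 4 - 3 * \<epsilon>) * norm v"
    if x: "x \<in> K" "P x \<ge> b / 3" for x
  proof -
    \<comment> \<open>Mean value theorem along \<open>a\<close>: at the intermediate point
      \<open>y\<close> the signed sum is at least \<open>b * P y\<close>, since every index in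
      \<open>J\<close> contributes with factor at least \<open>b\<close>. The loss
      \<open>3 * \<epsilon>\<close> is \<open>2 * \<epsilon>\<close> from \<open>u\<close> and
      \<epsilon> from \<open>z\<close>.\<close>
    have "\<exists>q>0. q < t \<and> u (x + t *\<^sub>R a) - u (x + 0 *\<^sub>R a) = (t - 0) * u' (x + q *\<^sub>R a) a"
    proof (rule MVT2[OF t(1)])
      fix q
      have lin: "linear (u' (x + q *\<^sub>R a))" using u(1) has_derivative_linear by blast
      have "((\<lambda>q. u (x + q *\<^sub>R a)) has_derivative (\<lambda>d. u' (x + q *\<^sub>R a) (d *\<^sub>R a))) (at q)"
        by (rule has_derivative_compose[OF _ u(1)]) (auto intro!: derivative_eq_intros)
      then show "((\<lambda>q. u (x + q *\<^sub>R a)) has_real_derivative u' (x + q *\<^sub>R a) a) (at q)"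
        by (simp add: has_field_derivative_def linear_scale[OF lin] mult_commute_abs)
    qed
    then obtain q where q: "0 < q" "q < t" "u (x + t *\<^sub>R a) - u x = t * u' (x + q *\<^sub>R a) a"
      by auto
    define y where "y = x + q *\<^sub>R a"
    have yx: "norm (y - x) = q" using q a by (simp add: y_def)
    have "infdist y K < r1" using infdist_le[OF x(1), of y] yx q t by (simp add: dist_norm)
    then have "y \<in> N" by (rule r1)
    have "b\<^sup>2 / 4 \<le> b * P y"
    proof -
      have "B * q \<le> B * t" using B q by (intro mult_left_mono) auto
      then have "P y \<ge> b / 4" using P_lip[of y x] yx t(4) x(2) by simp
      then show ?thesis using b by (simp add: power2_eq_square)
    qed
    also have "\<dots> \<le> (\<Sum>i\<in>J. s i * \<phi> i y * (a \<bullet> e i))"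
      unfolding P_def sum_distrib_left
    proof (rule sum_mono)
      fix i assume i: "i \<in> J"
      then have "b * \<phi> i y \<le> (s i * (a \<bullet> e i)) * \<phi> i y" using s(2) \<phi>0 J by (intro mult_right_mono) auto
      then show "b * \<phi> i y \<le> s i * \<phi> i y * (a \<bullet> e i)" by (simp add: mult_ac)
    qed
    also have "\<dots> \<le> u' y a + 2 * \<epsilon>"
      using near[OF \<open>y \<in> N\<close>, of a] a by simp
    finally have "u' y a \<ge> b\<^sup>2 / 4 - 2 * \<epsilon>" by simp
    then have "u (x + t *\<^sub>R a) - u x \<ge> t * (b\<^sup>2 / 4 - 2 * \<epsilon>)"
      unfolding q(3) y_def[symmetric] using t by (intro mult_left_mono) auto
    moreover have "\<bar>z (x + t *\<^sub>R a) - z x\<bar> \<le> \<epsilon> * t"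
      using z(2)[of x] z(2)[of "x + t *\<^sub>R a"] w by simp
    ultimately have "h (x + t *\<^sub>R a) - h x \<ge> (b\<^sup>2 / 4 - 3 * \<epsilon>) * t"
      by (simp add: h_def algebra_simps)
    then show ?thesis using t r a by (intro exI[of _ "t *\<^sub>R a"]) auto
  qed
  ultimately have "stage K {x\<in>K. P x \<ge> b / 3} U 6 (4 * \<epsilon>) (b\<^sup>2 / 4 - 3 * \<epsilon>) \<eta> r h"
    using r t unfolding stage_def by auto
  then show ?thesis unfolding P_def by blast
qed

text \<open>Dividing by \<open>1 + B\<close> instead of \<open>B\<close> gives functions
  differentiable everywhere with sum below 1, at the price of a sum \<open>B / (1 + B)\<close> on
  the covered set. On its half ball a bump is at least \<open>(3 / 4)\<^sup>2 = 9 / 16\<close>, so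
  \<open>B \<ge> 1 / 2\<close> and the sum is at least \<open>1 / 3\<close>.\<close>

lemma bump_partition:
  fixes I :: "'a::euclidean_space set" and R :: "'a \<Rightarrow> real"
  assumes I: "finite I" and R_pos: "\<forall>i\<in>I. R i > 0"
  shows "\<exists>\<phi> \<phi>' L. L \<ge> 0 \<and> (\<forall>i\<in>I. \<forall>x. (\<phi> i has_derivative \<phi>' i x) (at x)) \<and>
    (\<forall>i\<in>I. \<forall>x v. \<bar>\<phi>' i x v\<bar> \<le> L * norm v) \<and> (\<forall>i\<in>I. \<forall>x. \<phi> i x \<ge> 0) \<and>
    (\<forall>x. (\<Sum>i\<in>I. \<phi> i x) \<le> 1) \<and> (\<forall>i\<in>I. \<forall>x. x \<notin> cball i (R i) \<longrightarrow> \<phi> i x = 0) \<and>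
    (\<forall>x\<in>(\<Union>i\<in>I. ball i (R i / 2)). (\<Sum>i\<in>I. \<phi> i x) \<ge> 1 / 3)"
proof -
  have R: "R i > 0" if "i \<in> I" for i using R_pos that by blast
  define b where "b i x = mollifier (R i) (x - i) / R i ^ 4" for i x
  define b' where "b' i x v = - 4 * max 0 ((R i)\<^sup>2 - (x - i) \<bullet> (x - i)) * ((x - i) \<bullet> v) / R i ^ 4" for i x v
  define B where "B x = (\<Sum>i\<in>I. b i x)" for x
  define B' where "B' x v = (\<Sum>i\<in>I. b' i x v)" for x v
  \<comment> \<open>Each bump has slope at most \<open>4 / R i\<close>; the quotient rule later
    doubles the sum of these bounds.\<close>
  define L where "L = (\<Sum>i\<in>I. 4 / R i)"
  have b0: "b i x \<ge> 0" for i x by (simp add: b_def mollifier_nonneg)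
  have B0: "B x \<ge> 0" for x by (simp add: B_def sum_nonneg b0)
  have L0: "L \<ge> 0" unfolding L_def by (rule sum_nonneg) (simp add: R less_imp_le)
  have b: "(b i has_derivative b' i x) (at x)" for i x
  proof -
    have "((\<lambda>x. mollifier (R i) (x - i)) has_derivative
        (\<lambda>v. - 4 * max 0 ((R i)\<^sup>2 - (x - i) \<bullet> (x - i)) * ((x - i) \<bullet> v))) (at x)"
      by (rule has_derivative_compose[of "\<lambda>x. x - i" "\<lambda>v. v" x UNIV, OF _ has_derivative_mollifier])
        (auto intro!: derivative_eq_intros)
    from has_derivative_mult_left[OF this, of "inverse (R i ^ 4)"] show ?thesis
      by (simp add: b_def[abs_def] b'_def[abs_def] divide_inverse)
  qed
  have b'_le: "\<bar>b' i x v\<bar> \<le> 4 / R i * norm v" if i: "i \<in> I" for i x v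
  proof (cases "norm (x - i) \<le> R i")
    case True
    let ?q = "max 0 ((R i)\<^sup>2 - (x - i) \<bullet> (x - i))"
    have "?q \<le> (R i)\<^sup>2" by simp
    moreover have "\<bar>(x - i) \<bullet> v\<bar> \<le> R i * norm v"
      using Cauchy_Schwarz_ineq2[of "x - i" v] True mult_right_mono[OF True, of "norm v"] by simp
    ultimately have "4 * ?q * \<bar>(x - i) \<bullet> v\<bar> \<le> 4 * (R i)\<^sup>2 * (R i * norm v)"
      by (intro mult_mono) auto
    then have "\<bar>b' i x v\<bar> \<le> 4 * (R i)\<^sup>2 * (R i * norm v) / R i ^ 4"
      by (simp add: b'_def abs_mult divide_right_mono)
    also have "\<dots> = 4 / R i * norm v"
      using R[OF i] by (simp add: field_simps power2_eq_square power4_eq_xxxx)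
    finally show ?thesis .
  next
    case False
    then have "(R i)\<^sup>2 \<le> (x - i) \<bullet> (x - i)"
      using R[OF i] power_mono[of "R i" "norm (x - i)" 2] by (simp add: power2_norm_eq_inner)
    then have "b' i x v = 0" by (simp add: b'_def)
    then show ?thesis using R[OF i] by simp
  qed
  have L_ge: "4 / R i \<le> L" if "i \<in> I" for i
    unfolding L_def using R by (intro member_le_sum[OF that]) (auto intro: less_imp_le I)
  have B: "(B has_derivative B' x) (at x)" for x
    unfolding B_def B'_def by (intro has_derivative_sum b)
  have B'_le: "\<bar>B' x v\<bar> \<le> L * norm v" for x v
    unfolding B'_def L_def sum_distrib_right by (rule order_trans[OF sum_abs sum_mono]) (rule b'_le)
  define \<phi> where "\<phi> i x = b i x / (1 + B x)" for i x
  define \<phi>' where "\<phi>' i x v = (b' i x v * (1 + B x) - b i x * B' x v) / ((1 + B x) * (1 + B x))" for i x v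
  have pos: "1 + B x > 0" for x using B0[of x] by simp
  have b_le_B: "b i x \<le> B x" if "i \<in> I" for i x
    unfolding B_def by (rule member_le_sum[OF that]) (auto intro: b0 I)
  have 1: "(\<phi> i has_derivative \<phi>' i x) (at x)" for i x
  proof -
    have "1 + B x \<noteq> 0" using pos[of x] by simp
    have "((\<lambda>x. 1 + B x) has_derivative B' x) (at x)"
      using has_derivative_add[OF has_derivative_const B, of 1 x] by simp
    from has_derivative_divide'[OF b this \<open>1 + B x \<noteq> 0\<close>, of i] show ?thesis
      by (simp add: \<phi>_def[abs_def] \<phi>'_def[abs_def])
  qed
  have 2: "\<bar>\<phi>' i x v\<bar> \<le> (2 * L) * norm v" if i: "i \<in> I" for i x v
  proof -
    let ?c = "1 + B x"
    have c: "?c \<ge> 1" using B0[of x] by simp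
    have "\<bar>b' i x v\<bar> \<le> L * norm v"
      by (rule order_trans[OF b'_le[OF i]]) (intro mult_right_mono L_ge i, simp)
    then have "\<bar>b' i x v * ?c\<bar> \<le> L * norm v * ?c"
      using c by (simp add: abs_mult mult_right_mono)
    moreover have "\<bar>b i x * B' x v\<bar> \<le> ?c * (L * norm v)"
      using B'_le[of x v] b0[of i x] b_le_B[OF i, of x] by (auto simp: abs_mult intro!: mult_mono)
    ultimately have "\<bar>b' i x v * ?c - b i x * B' x v\<bar> \<le> L * norm v * ?c + ?c * (L * norm v)" by linarith
    also have "\<dots> = (2 * L * norm v) * ?c" by simp
    also have "\<dots> \<le> (2 * L * norm v) * (?c * ?c)"
      using c L0 by (intro mult_left_mono) auto
    finally have "\<bar>b' i x v * ?c - b i x * B' x v\<bar> / (?c * ?c) \<le> 2 * L * norm v"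
      using c by (subst pos_divide_le_eq) auto
    moreover have "\<bar>\<phi>' i x v\<bar> = \<bar>b' i x v * ?c - b i x * B' x v\<bar> / (?c * ?c)"
      using c by (simp add: \<phi>'_def abs_mult)
    ultimately show ?thesis by simp
  qed
  have 3: "\<phi> i x \<ge> 0" for i x using b0 B0 by (simp add: \<phi>_def)
  have sum: "(\<Sum>i\<in>I. \<phi> i x) = B x / (1 + B x)" for x
    by (simp add: \<phi>_def B_def sum_divide_distrib)
  have 4: "(\<Sum>i\<in>I. \<phi> i x) \<le> 1" for x
    unfolding sum using pos[of x] by simp
  have 5: "\<phi> i x = 0" if "i \<in> I" "x \<notin> cball i (R i)" for i x
    using that mollifier_eq_0[OF R[OF that(1)], of "x - i"]
    by (simp add: \<phi>_def b_def dist_norm norm_minus_commute)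
  have 6: "(\<Sum>i\<in>I. \<phi> i x) \<ge> 1 / 3" if x: "x \<in> (\<Union>i\<in>I. ball i (R i / 2))" for x
  proof -
    obtain i where "i \<in> I" "x \<in> ball i (R i / 2)" using x by blast
    then have i: "i \<in> I" "norm (x - i) < R i / 2" by (simp_all add: dist_norm norm_minus_commute)
    have "(x - i) \<bullet> (x - i) \<le> (R i / 2)\<^sup>2"
      using i(2) power_mono[of "norm (x - i)" "R i / 2" 2] by (simp add: power2_norm_eq_inner)
    moreover have "(R i / 2)\<^sup>2 = (R i)\<^sup>2 / 4" by (simp add: power_divide)
    ultimately have "(R i)\<^sup>2 * (3 / 4) \<le> max 0 ((R i)\<^sup>2 - (x - i) \<bullet> (x - i))"
      by linarith
    then have "((R i)\<^sup>2 * (3 / 4))\<^sup>2 \<le> mollifier (R i) (x - i)"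
      unfolding mollifier_def by (rule power_mono) simp
    then have "((R i)\<^sup>2 * (3 / 4))\<^sup>2 / R i ^ 4 \<le> b i x"
      unfolding b_def by (rule divide_right_mono) simp
    moreover have "((R i)\<^sup>2 * (3 / 4))\<^sup>2 / R i ^ 4 = 9 / 16"
      using R[OF i(1)] by (simp add: power_mult_distrib power_divide)
    ultimately have "B x \<ge> 1 / 2" using b_le_B[OF i(1), of x] by linarith
    then show ?thesis unfolding sum using pos[of x] by (simp add: field_simps)
  qed
  show ?thesis
    using 1 2 3 4 5 6 L0 by (intro exI[of _ \<phi>] exI[of _ \<phi>'] exI[of _ "2 * L"]) auto
qed

section \<open>Width under inclusion and scaling, and choice of null directions\<close>

lemma width_mono: "A \<subseteq> B \<Longrightarrow> width e \<alpha> A \<le> width e \<alpha> B"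
  unfolding width_def by (auto intro!: INF_superset_mono)

lemma width_scale: "c > 0 \<Longrightarrow> width (c *\<^sub>R e) \<alpha> A = width e \<alpha> A"
proof -
  assume c: "c > 0"
  have "cone (c *\<^sub>R e) \<alpha> = cone e \<alpha>"
    using c by (auto simp: cone_def mult.left_commute)
  then show ?thesis using c by (simp add: width_def width_open_def cone_curves_def)
qed

lemma cone_unrectifiable_subset:
  assumes E: "cone_unrectifiable E" and K: "K \<subseteq> E"
  shows "cone_unrectifiable K"
proof -
  have "normal_cone K x \<noteq> {0}" if x: "x \<in> K" for x
  proof -
    \<comment> \<open>As 0 always belongs to the normal cone, differing from \<open>{0}\<close>
      means containing a nonzero direction rather than being empty.\<close>
    have "0 \<in> normal_cone E x" by (auto simp: normal_cone_def width_def intro: exI[of _ 1])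
    moreover have "normal_cone E x \<noteq> {0}" using E x K by (auto simp: cone_unrectifiable_def)
    ultimately obtain e where e: "e \<in> normal_cone E x" "e \<noteq> 0" by blast
    have "e \<in> normal_cone K x"
      unfolding normal_cone_def
    proof (intro CollectI allI impI)
      fix \<epsilon> :: real assume "\<epsilon> > 0"
      then obtain r where r: "r > 0" "width e \<epsilon> (ball x r \<inter> E) = 0"
        using e(1) by (auto simp: normal_cone_def)
      have "width e \<epsilon> (ball x r \<inter> K) \<le> width e \<epsilon> (ball x r \<inter> E)"
        by (rule width_mono) (use K in auto)
      then show "\<exists>r>0. width e \<epsilon> (ball x r \<inter> K) = 0" using r by auto
    qed
    then show ?thesis using e(2) by blast
  qed
  then show ?thesis by (simp add: cone_unrectifiable_def)
qed

text \<open>Width depends on \<open>e\<close> only through its ray, so \<open>e\<close> can be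
  normalised. The balls are closed because they become the closed sets \<open>C i\<close> carrying
  the partition functions.\<close>

lemma cone_unrectifiable_direction:
  assumes "cone_unrectifiable K" "x \<in> K" and \<epsilon>: "\<epsilon> > 0" and \<rho>: "\<rho> > 0"
  shows "\<exists>e r. norm e = 1 \<and> 0 < r \<and> r < \<rho> \<and> width e \<epsilon> (K \<inter> cball x r) = 0"
proof -
  have "0 \<in> normal_cone K x" by (auto simp: normal_cone_def width_def intro: exI[of _ 1])
  moreover have "normal_cone K x \<noteq> {0}" using assms by (auto simp: cone_unrectifiable_def)
  ultimately obtain e where e: "e \<in> normal_cone K x" "e \<noteq> 0" by blast
  then obtain r where r: "r > 0" "width e \<epsilon> (ball x r \<inter> K) = 0"
    using \<epsilon> by (auto simp: normal_cone_def)
  define r' where "r' = min r \<rho> / 2"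
  have r': "0 < r'" "r' < \<rho>" "r' < r" using r \<rho> by (auto simp: r'_def)
  have "width ((1 / norm e) *\<^sub>R e) \<epsilon> (K \<inter> cball x r') = width e \<epsilon> (K \<inter> cball x r')"
    using e by (intro width_scale) simp
  also have "\<dots> \<le> width e \<epsilon> (ball x r \<inter> K)"
    by (rule width_mono) (use r' in auto)
  finally have "width ((1 / norm e) *\<^sub>R e) \<epsilon> (K \<inter> cball x r') = 0" using r by simp
  then show ?thesis using e r' by (intro exI[of _ "(1 / norm e) *\<^sub>R e"] exI[of _ r']) simp
qed

text \<open>The basis vectors serve as test directions \<open>a\<close> in
  \<open>one_direction_stage\<close>: by pigeonhole every point of \<open>K\<close> is handled by
  one of them, and the finitely many resulting stages are superposed. The constants \<open>c\<close>
  and \<open>M\<close> come from the dimension alone.\<close>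

lemma full_stage:
  fixes K :: "(real^'n) set"
  assumes K: "compact K" "K \<noteq> {}" and cu: "cone_unrectifiable K"
  shows "\<exists>c>0. \<exists>M\<ge>0. \<forall>d>0. \<forall>\<rho>>0. \<exists>h r. stage K K {x. infdist x K < \<rho>} M d c \<rho> r h"
proof -
  define n where "n = real (DIM(real^'n))"
  have n: "n \<ge> 1" unfolding n_def using DIM_positive[where 'a="real^'n"] by linarith
  define b where "b = 1 / n"
  have b: "b > 0" using n by (simp add: b_def)
  have "\<exists>h r. stage K K {x. infdist x K < \<rho>} (n * 6) d (b\<^sup>2 / 8) \<rho> r h" if d: "d > 0" and \<rho>: "\<rho> > 0" for d \<rho>
  proof -
    \<comment> \<open>Makes the total flatness \<open>n * (4 * \<epsilon>)\<close> at most
      \<open>d\<close> and leaves half of \<open>b\<^sup>2 / 4\<close> after all losses.\<close>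
    define \<epsilon> where "\<epsilon> = min 1 (min (d / (4 * n)) (b\<^sup>2 / (8 * (3 + 4 * n))))"
    have eps: "0 < \<epsilon>" "\<epsilon> \<le> 1" "n * (4 * \<epsilon>) \<le> d" "(3 + 4 * n) * \<epsilon> \<le> b\<^sup>2 / 8"
    proof -
      show "0 < \<epsilon>" "\<epsilon> \<le> 1" using d n b by (auto simp: \<epsilon>_def)
      have "\<epsilon> \<le> d / (4 * n)" "\<epsilon> \<le> b\<^sup>2 / (8 * (3 + 4 * n))" by (simp_all add: \<epsilon>_def)
      then show "n * (4 * \<epsilon>) \<le> d" "(3 + 4 * n) * \<epsilon> \<le> b\<^sup>2 / 8"
        using n by (simp_all add: pos_le_divide_eq mult_ac)
    qed
    have "\<forall>x\<in>K. \<exists>e r. norm e = 1 \<and> 0 < r \<and> r < \<rho> \<and> width e (\<epsilon> / 2) (K \<inter> cball x r) = 0"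
      using cone_unrectifiable_direction[OF cu] eps \<rho> by simp
    then obtain e R where e: "\<And>x. x \<in> K \<Longrightarrow> norm (e x) = 1" and R: "\<And>x. x \<in> K \<Longrightarrow> 0 < R x" "\<And>x. x \<in> K \<Longrightarrow> R x < \<rho>"
      and null: "\<And>x. x \<in> K \<Longrightarrow> width (e x) (\<epsilon> / 2) (K \<inter> cball x (R x)) = 0"
      by metis
    have "K \<subseteq> (\<Union>x\<in>K. ball x (R x / 2))" using R by force
    then obtain I where I: "I \<subseteq> K" "finite I" "K \<subseteq> (\<Union>x\<in>I. ball x (R x / 2))"
      using compactE_image[OF K(1), of K "\<lambda>x. ball x (R x / 2)"] by auto
    have RI: "\<forall>i\<in>I. R i > 0" using R I by auto
    from bump_partition[of I R, OF I(2) RI] obtain \<phi> \<phi>' L where Q: "L \<ge> 0"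
      "\<forall>i\<in>I. \<forall>x. (\<phi> i has_derivative \<phi>' i x) (at x)"
      "\<forall>i\<in>I. \<forall>x v. \<bar>\<phi>' i x v\<bar> \<le> L * norm v" "\<forall>i\<in>I. \<forall>x. \<phi> i x \<ge> 0"
      "\<forall>x. (\<Sum>i\<in>I. \<phi> i x) \<le> 1" "\<forall>i\<in>I. \<forall>x. x \<notin> cball i (R i) \<longrightarrow> \<phi> i x = 0"
      "\<forall>x\<in>(\<Union>i\<in>I. ball i (R i / 2)). (\<Sum>i\<in>I. \<phi> i x) \<ge> 1 / 3"
      by (elim exE conjE) (rule that)
    have L: "L \<ge> 0" and \<phi>: "\<And>i x. i \<in> I \<Longrightarrow> (\<phi> i has_derivative \<phi>' i x) (at x)"
      and \<phi>': "\<And>i x v. i \<in> I \<Longrightarrow> \<bar>\<phi>' i x v\<bar> \<le> L * norm v"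
      and \<phi>0: "\<And>i x. i \<in> I \<Longrightarrow> \<phi> i x \<ge> 0" and \<phi>1: "\<And>x. (\<Sum>i\<in>I. \<phi> i x) \<le> 1"
      and off: "\<And>i x. i \<in> I \<Longrightarrow> x \<notin> cball i (R i) \<Longrightarrow> \<phi> i x = 0"
      using Q(1-6) by simp_all
    have cover: "(\<Sum>i\<in>I. \<phi> i x) \<ge> 1 / 3" if "x \<in> (\<Union>i\<in>I. ball i (R i / 2))" for x
      using Q(7) that by blast
    define J where "J a = {i\<in>I. \<bar>e i \<bullet> a\<bar> \<ge> b}" for a
    define X where "X a = {x\<in>K. (\<Sum>i\<in>J a. \<phi> i x) \<ge> b / 3}" for a
    let ?U = "{x. infdist x K < \<rho>}"
    have sub: "cball i (R i) \<subseteq> ?U" if "i \<in> I" for i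
    proof
      fix x assume "x \<in> cball i (R i)"
      then have "dist x i \<le> R i" by (simp add: dist_commute)
      moreover have "i \<in> K" using that I(1) by blast
      ultimately show "x \<in> ?U" using infdist_le[of i K x] R(2)[of i] by simp
    qed
    have "\<exists>h r. stage K (X a) ?U 6 (4 * \<epsilon>) (b\<^sup>2 / 4 - 3 * \<epsilon>) \<eta> r h" if a: "a \<in> Basis" and \<eta>: "\<eta> > 0" for a \<eta>
      unfolding X_def J_def
      by (rule one_direction_stage[OF K I(2) eps(1,2) \<eta>, of "\<lambda>i. cball i (R i)" ?U e \<phi> \<phi>' L])
        (use e null \<phi> \<phi>' L \<phi>0 \<phi>1 off b a I(1) sub in auto)
    then have "\<exists>h r. stage K (\<Union>a\<in>Basis. X a) ?U (n * 6) (n * (4 * \<epsilon>)) ((b\<^sup>2 / 4 - 3 * \<epsilon>) - n * (4 * \<epsilon>)) \<rho> r h"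
      unfolding n_def using eps \<rho> by (intro stage_family_union) (auto simp: X_def)
    moreover have "(\<Union>a\<in>Basis. X a) = K"
    proof
      show "(\<Union>a\<in>Basis. X a) \<subseteq> K" by (auto simp: X_def)
      show "K \<subseteq> (\<Union>a\<in>Basis. X a)"
      proof
        fix x assume x: "x \<in> K"
        \<comment> \<open>The coordinates of a unit vector have absolute sum at least 1, so one of
          them is at least \<open>b = 1 / n\<close> in absolute value.\<close>
        have ex: "\<exists>a\<in>Basis. i \<in> J a" if i: "i \<in> I" for i
        proof (rule ccontr)
          assume "\<not> (\<exists>a\<in>Basis. i \<in> J a)"
          then have "(\<Sum>a\<in>Basis. \<bar>e i \<bullet> a\<bar>) < (\<Sum>a\<in>(Basis::(real^'n) set). b)"
            using i by (intro sum_strict_mono) (auto simp: J_def not_le)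
          moreover have "norm (e i) \<le> (\<Sum>a\<in>Basis. \<bar>e i \<bullet> a\<bar>)" by (rule norm_le_l1)
          ultimately show False using e[of i] i I(1) n by (auto simp: b_def n_def)
        qed
        show "x \<in> (\<Union>a\<in>Basis. X a)"
        proof (rule ccontr)
          assume "x \<notin> (\<Union>a\<in>Basis. X a)"
          then have *: "(\<Sum>i\<in>J a. \<phi> i x) < b / 3" if "a \<in> Basis" for a using x that by (auto simp: X_def not_le)
          \<comment> \<open>Every \<open>i\<close> lies in some \<open>J a\<close>, so the
            \<open>n\<close> sums over the sets \<open>J a\<close> add up to at least
            \<open>1 / 3\<close> and cannot all be below \<open>b / 3\<close>.\<close>
          have "1 / 3 \<le> (\<Sum>i\<in>I. \<phi> i x)" using cover x I(3) by blast
          also have "\<dots> \<le> (\<Sum>i\<in>I. \<Sum>a\<in>Basis. if i \<in> J a then \<phi> i x else 0)"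
          proof (rule sum_mono)
            fix i assume i: "i \<in> I"
            then obtain a where a: "a \<in> Basis" "i \<in> J a" using ex by blast
            have "(if i \<in> J a then \<phi> i x else 0) \<le> (\<Sum>a\<in>Basis. if i \<in> J a then \<phi> i x else 0)"
              by (rule member_le_sum[OF a(1)]) (use \<phi>0[OF i] in auto)
            then show "\<phi> i x \<le> (\<Sum>a\<in>Basis. if i \<in> J a then \<phi> i x else 0)" using a by simp
          qed
          also have "\<dots> = (\<Sum>a\<in>Basis. \<Sum>i\<in>I. if i \<in> J a then \<phi> i x else 0)" by (rule sum.swap)
          also have "\<dots> = (\<Sum>a\<in>Basis. \<Sum>i\<in>J a. \<phi> i x)"
            using I(2) by (intro sum.cong[OF refl] sum.mono_neutral_cong_right) (auto simp: J_def)
          also have "\<dots> < (\<Sum>a\<in>(Basis::(real^'n) set). b / 3)"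
            by (rule sum_strict_mono) (use * in auto)
          also have "\<dots> = 1 / 3" using n by (simp add: b_def n_def)
          finally show False by simp
        qed
      qed
    qed
    ultimately obtain h r where "stage K K ?U (n * 6) (n * (4 * \<epsilon>)) ((b\<^sup>2 / 4 - 3 * \<epsilon>) - n * (4 * \<epsilon>)) \<rho> r h"
      by auto
    then have "stage K K ?U (n * 6) d (b\<^sup>2 / 8) \<rho> r h"
      by (rule stage_mono) (use eps in \<open>auto simp: algebra_simps\<close>)
    then show ?thesis by blast
  qed
  moreover have "b\<^sup>2 / 8 > 0" "n * 6 \<ge> 0" using b n by auto
  ultimately show ?thesis by blast
qed

subsection \<open>Oscillation on compact sets\<close>

text \<open>Flatness is required on whole spheres because the direction of the steep
  \<open>v\<close> is not known in advance. The factor 4 leaves room for a perturbation.\<close>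

definition oscillates :: "('a::real_normed_vector \<Rightarrow> real) \<Rightarrow> 'a \<Rightarrow> real \<Rightarrow> bool" where
  "oscillates f x c \<longleftrightarrow>
     (\<forall>R>0. \<exists>v. v \<noteq> 0 \<and> norm v < R \<and> c * norm v \<le> \<bar>f (x + v) - f x\<bar>) \<and>
     (\<forall>R>0. \<exists>r>0. r < R \<and> (\<forall>v. norm v = r \<longrightarrow> \<bar>f (x + v) - f x\<bar> \<le> c / 4 * norm v))"

lemma oscillates_scale:
  assumes "oscillates f x c" "a > 0"
  shows "oscillates (\<lambda>x. a * f x) x (a * c)"
proof -
  have "\<bar>a * f (x + v) - a * f x\<bar> = a * \<bar>f (x + v) - f x\<bar>" for v
    using assms(2) by (simp add: abs_mult flip: right_diff_distrib)
  then show ?thesis using assms by (simp add: oscillates_def mult.assoc)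
qed

text \<open>With approximation error \<open>c / 16\<close> and perturbation \<open>c / 8\<close>, a
  derivative \<open>D\<close> would satisfy \<open>\<bar>D w\<bar> \<le> 7 * c / 16 * norm w\<close>
  on the flat sphere but \<open>\<bar>D v\<bar> \<ge> 13 * c / 16 * norm v\<close> at a steep
  \<open>v\<close>; linearity equates the quotients when \<open>w\<close> is a positive multiple of
  \<open>v\<close>.\<close>

lemma oscillates_perturbed_not_differentiable:
  assumes osc: "oscillates f x c" and c: "c > 0" and g: "\<And>v. \<bar>g (x + v) - g x\<bar> \<le> c / 8 * norm v"
  shows "\<not> (\<lambda>x. f x + g x) differentiable (at x)"
proof
  assume "(\<lambda>x. f x + g x) differentiable (at x)"
  then obtain D where D: "((\<lambda>x. f x + g x) has_derivative D) (at x)" by (auto simp: differentiable_def)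
  interpret D: bounded_linear D using D by (rule has_derivative_bounded_linear)
  have "c / 16 > 0" using c by simp
  then obtain R where R: "R > 0" "\<And>y. norm (y - x) < R \<Longrightarrow> norm ((f y + g y) - (f x + g x) - D (y - x)) \<le> c / 16 * norm (y - x)"
    using D unfolding has_derivative_at_alt by blast
  have lin: "\<bar>(f (x + v) - f x) - D v\<bar> \<le> 3 * c / 16 * norm v" if "norm v < R" for v
  proof -
    have "\<bar>(f (x + v) + g (x + v)) - (f x + g x) - D v\<bar> \<le> c / 16 * norm v"
      using R(2)[of "x + v"] that by simp
    then show ?thesis using g[of v] by linarith
  qed
  obtain v where v: "v \<noteq> 0" "norm v < R" "c * norm v \<le> \<bar>f (x + v) - f x\<bar>"
    using osc R(1) by (auto simp: oscillates_def)
  obtain r where r: "0 < r" "r < R" "\<And>w. norm w = r \<Longrightarrow> \<bar>f (x + w) - f x\<bar> \<le> c / 4 * norm w"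
    using osc R(1) by (auto simp: oscillates_def)
  define w where "w = (r / norm v) *\<^sub>R v"
  have w: "norm w = r" using r v by (simp add: w_def)
  have "\<bar>D w\<bar> \<le> 7 * c / 16 * norm w"
  proof -
    have "\<bar>(f (x + w) - f x) - D w\<bar> \<le> 3 * c / 16 * norm w" by (rule lin) (use w r in simp)
    then show ?thesis using r(3)[OF w] by linarith
  qed
  moreover have "\<bar>D w\<bar> = r / norm v * \<bar>D v\<bar>"
    using r by (simp add: w_def D.scaleR abs_mult)
  moreover have "7 * c / 16 * norm w = r / norm v * (7 * c / 16 * norm v)" using w v by simp
  ultimately have "r / norm v * \<bar>D v\<bar> \<le> r / norm v * (7 * c / 16 * norm v)"
    by metis
  then have "\<bar>D v\<bar> \<le> 7 * c / 16 * norm v"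
    using mult_le_cancel_left_pos[of "r / norm v"] r v by (metis divide_pos_pos zero_less_norm_iff)
  moreover have "\<bar>D v\<bar> \<ge> c * norm v - 3 * c / 16 * norm v" using lin[OF v(2)] v(3) by linarith
  ultimately have "6 * (c * norm v) \<le> 0" by simp
  then show False using c v by (simp add: mult_le_0_iff)
qed

lemma compact_set_oscillation:
  fixes K :: "(real^'n) set"
  assumes K: "compact K" "K \<noteq> {}" and cu: "cone_unrectifiable K"
  shows "\<exists>f c L. c > 0 \<and> L-lipschitz_on UNIV f \<and> (\<forall>x. \<bar>f x\<bar> \<le> L) \<and>
    (\<forall>x\<in>-K. f differentiable (at x)) \<and> (\<forall>x\<in>K. oscillates f x c)"
proof -
  obtain c M where c: "c > 0" and M: "M \<ge> 0"
    and ex: "\<And>d \<rho>. d > 0 \<Longrightarrow> \<rho> > 0 \<Longrightarrow> \<exists>h r. stage K K {x. infdist x K < \<rho>} M d c \<rho> r h"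
    using full_stage[OF K cu] by blast
  obtain H R where HR: "\<And>d \<rho>. d > 0 \<Longrightarrow> \<rho> > 0 \<Longrightarrow> stage K K {x. infdist x K < \<rho>} M d c \<rho> (R d \<rho>) (H d \<rho>)"
    using ex by metis
  \<comment> \<open>The errors will be \<open>4 * \<theta> \<le> c / 2\<close> at steep vectors and
    \<open>6 * \<theta> \<le> c / 8\<close> on flat spheres.\<close>
  define \<theta> where "\<theta> = c / 64"
  have \<theta>: "\<theta> > 0" using c by (simp add: \<theta>_def)
  define \<delta> where "\<delta> k = \<theta> * (1/2)^k" for k :: nat
  have \<delta>: "\<delta> k > 0" for k using \<theta> by (simp add: \<delta>_def)
  have \<delta>_sum: "(\<Sum>k<N. \<delta> k) \<le> 2 * \<theta>" for N
  proof -
    have "(\<Sum>k<N. \<delta> k) = 2 * \<theta> - 2 * \<delta> N" by (induction N) (auto simp: \<delta>_def)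
    then show ?thesis using \<delta>[of N] by simp
  qed
  \<comment> \<open>Halving the inner radius confines the next stage to the region where this one is
    flat, and turns the tail bound \<open>2 * \<theta> * \<rho> (Suc k)\<close> into
    \<open>\<theta> * r k\<close>.\<close>
  define \<rho> where "\<rho> = rec_nat 1 (\<lambda>k p. R (\<delta> k) p / 2)"
  define r where "r k = R (\<delta> k) (\<rho> k)" for k
  define h where "h k = H (\<delta> k) (\<rho> k)" for k
  have \<rho>_Suc: "\<rho> (Suc k) = r k / 2" for k by (simp add: \<rho>_def r_def)
  have \<rho>: "\<rho> k > 0" for k
  proof (induction k)
    case (Suc k)
    then show ?case using HR[OF \<delta>[of k] Suc] unfolding \<rho>_Suc by (simp add: stage_def r_def)
  qed (simp add: \<rho>_def)
  have S: "stage K K {x. infdist x K < \<rho> k} M (\<delta> k) c (\<rho> k) (r k) (h k)" for k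
    unfolding r_def h_def by (rule HR[OF \<delta> \<rho>])
  have r: "0 < r k" "r k \<le> \<rho> k" for k using S[of k] by (auto simp: stage_def)
  have h_le: "\<bar>h k x\<bar> \<le> \<delta> k * \<rho> k" for k x using S[of k] by (auto simp: stage_def)
  have h_0: "h k x = 0" if "infdist x K \<ge> \<rho> k" for k x using S[of k] that by (auto simp: stage_def)
  have h_M: "slope_le (h k) x M" for k x using S[of k] by (auto simp: stage_def)
  have h_flat: "slope_le (h k) x (\<delta> k)" if "infdist x K < r k" for k x using S[of k] that by (auto simp: stage_def)
  have h_osc: "\<exists>v. r k \<le> norm v \<and> norm v \<le> \<rho> k \<and> \<bar>h k (x + v) - h k x\<bar> \<ge> c * norm v" if "x \<in> K" for k x
    using S[of k] that by (auto simp: stage_def)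
  have \<rho>_half: "\<rho> (Suc k) \<le> \<rho> k / 2" for k using r[of k] by (simp add: \<rho>_Suc)
  have \<rho>_pow: "\<rho> k \<le> (1/2)^k" for k
  proof (induction k)
    case (Suc k)
    then show ?case using \<rho>_half[of k] by simp
  qed (simp add: \<rho>_def)
  have \<rho>_mono: "\<rho> k \<le> \<rho> j" if "j \<le> k" for j k
    by (rule lift_Suc_antimono_le[of \<rho>, OF _ that]) (use \<rho>_half \<rho> in \<open>smt (verit) field_sum_of_halves\<close>)
  have \<rho>_less: "\<exists>k. \<rho> k < e" if "e > 0" for e
    using real_arch_pow_inv[OF that, of "1/2"] \<rho>_pow
    by (metis half_gt_zero_iff less_numeral_extra(1) field_sum_of_halves less_add_same_cancel1 order_le_less_trans)
  define F where "F N x = (\<Sum>k<N. h k x)" for N x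
  define f where "f x = (\<Sum>k. h k x)" for x
  have \<delta>\<rho>: "\<delta> k * \<rho> k \<le> \<delta> k" for k
    using \<rho>_mono[of 0 k] \<delta>[of k] by (simp add: \<rho>_def mult_left_le)
  have summ: "summable (\<lambda>k. h k x)" for x
  proof (rule summable_comparison_test')
    show "summable \<delta>" unfolding \<delta>_def by (intro summable_mult summable_geometric) simp
    show "norm (h k x) \<le> \<delta> k" for k using h_le[of k x] \<delta>\<rho>[of k] by simp
  qed
  have lim: "(\<lambda>N. F N x) \<longlonglongrightarrow> f x" for x
    unfolding F_def f_def by (rule summable_LIMSEQ[OF summ])
  have tail: "\<bar>f x - F m x\<bar> \<le> 2 * \<theta> * \<rho> m" for m x
  proof -
    have "\<bar>F N x - F m x\<bar> \<le> 2 * \<theta> * \<rho> m" if N: "N \<ge> m" for N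
    proof -
      have "F N x - F m x = (\<Sum>k=m..<N. h k x)"
        unfolding F_def using N by (simp add: sum_diff_nat_ivl[of 0 m N, symmetric] lessThan_atLeast0)
      also have "\<bar>\<dots>\<bar> \<le> (\<Sum>k=m..<N. \<delta> k * \<rho> m)"
      proof (rule order_trans[OF sum_abs sum_mono])
        fix k assume "k \<in> {m..<N}"
        then have "\<delta> k * \<rho> k \<le> \<delta> k * \<rho> m" using \<rho>_mono[of m k] \<delta>[of k] by (intro mult_left_mono) auto
        then show "\<bar>h k x\<bar> \<le> \<delta> k * \<rho> m" using h_le[of k x] by simp
      qed
      also have "\<dots> \<le> (\<Sum>k<N. \<delta> k) * \<rho> m"
        unfolding sum_distrib_right[symmetric] using \<rho>[of m] \<delta>
        by (intro mult_right_mono sum_mono2) (auto intro: less_imp_le)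
      also have "\<dots> \<le> 2 * \<theta> * \<rho> m" using \<delta>_sum[of N] \<rho>[of m] by (intro mult_right_mono) auto
      finally show ?thesis .
    qed
    moreover have "(\<lambda>N. \<bar>F N x - F m x\<bar>) \<longlonglongrightarrow> \<bar>f x - F m x\<bar>"
      by (intro tendsto_intros lim)
    ultimately show ?thesis by (intro LIMSEQ_le_const2) auto
  qed
  define L where "L = 2 * M + 2 * \<theta>"
  have F_slope: "slope_le (F N) x L" for N x
  proof -
    \<comment> \<open>\<open>m\<close> is the first stage whose neighbourhood misses
      \<open>x\<close>. Later stages vanish near \<open>x\<close>, those before \<open>m - 1\<close>
      are flat at \<open>x\<close>, so only \<open>m - 1\<close> and \<open>m\<close> may be steep.
      On \<open>K\<close> there is no such index: the default 0 is used and all stages are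
      flat.\<close>
    define m where "m = (if \<exists>k. infdist x K \<ge> \<rho> k then LEAST k. infdist x K \<ge> \<rho> k else 0)"
    have far: "\<exists>k. infdist x K \<ge> \<rho> k \<Longrightarrow> infdist x K \<ge> \<rho> m"
      unfolding m_def by (auto intro: LeastI)
    have near: "infdist x K < \<rho> k" if "k < m" for k
      using not_less_Least[of k "\<lambda>k. infdist x K \<ge> \<rho> k"] that by (auto simp: m_def not_le split: if_splits)
    have "slope_le (h j) x (\<delta> j + ((if j = m then M else 0) + (if Suc j = m then M else 0)))" for j
    proof -
      consider "infdist x K < \<rho> (Suc j)" | "j = m" | "Suc j = m" | "\<exists>k. infdist x K \<ge> \<rho> k" "m < j"
        using near[of "Suc j"] by (metis not_less linorder_neqE_nat Suc_lessI)
      then show ?thesis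
      proof cases
        case 1
        then have "infdist x K < r j" using r[of j] by (simp add: \<rho>_Suc)
        then show ?thesis using M by (intro slope_le_mono[OF h_flat]) auto
      next
        case 4
        then have "\<rho> j < infdist x K"
          using far \<rho>_half[of m] \<rho>_mono[of "Suc m" j] \<rho>[of m] by simp
        note j = this
        have "((\<lambda>_. 0) has_derivative (\<lambda>_. 0)) (at x)" by simp
        then have "(h j has_derivative (\<lambda>_. 0)) (at x)"
          by (rule has_derivative_transform_within_open[of _ _ _ _ "{y. \<rho> j < infdist y K}"])
            (use j in \<open>auto intro!: open_Collect_less continuous_intros simp: h_0\<close>)
        then have "slope_le (h j) x 0" by (rule slope_leI) simp
        then show ?thesis by (rule slope_le_mono) (use M \<delta>[of j] in auto)
      qed (rule slope_le_mono[OF h_M], use M \<delta>[of j] in auto)+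
    qed
    then have "slope_le (F N) x (\<Sum>j<N. \<delta> j + ((if j = m then M else 0) + (if Suc j = m then M else 0)))"
      unfolding F_def by (rule slope_le_sum)
    moreover have "(\<Sum>j<N. if j = m then M else 0) \<le> M" using M by (simp add: sum.delta)
    moreover have "(\<Sum>j<N. if Suc j = m then M else 0) \<le> M"
      using M by (cases m) (auto simp: sum.delta)
    ultimately show ?thesis
      using \<delta>_sum[of N] unfolding L_def by (elim slope_le_mono) (simp add: sum.distrib)
  qed
  have "L \<ge> 0" using M \<theta> by (simp add: L_def)
  have lip: "L-lipschitz_on UNIV f"
  proof (rule lipschitz_onI[OF _ \<open>L \<ge> 0\<close>])
    fix x y
    have "\<bar>F N y - F N x\<bar> \<le> L * norm (y - x)" for N
      by (rule slope_le_increment[of UNIV]) (use F_slope in auto)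
    moreover have "(\<lambda>N. \<bar>F N y - F N x\<bar>) \<longlonglongrightarrow> \<bar>f y - f x\<bar>" by (intro tendsto_intros lim)
    ultimately have "\<bar>f y - f x\<bar> \<le> L * norm (y - x)" by (intro LIMSEQ_le_const2) auto
    then show "dist (f x) (f y) \<le> L * dist x y" by (simp add: dist_norm norm_minus_commute)
  qed
  have bdd: "\<bar>f x\<bar> \<le> L" for x
    using tail[of x 0] M by (simp add: F_def \<rho>_def L_def)
  have diff: "f differentiable (at x)" if x: "x \<in> - K" for x
  proof -
    have "infdist x K > 0"
      using x K infdist_pos_not_in_closed[OF compact_imp_closed] by auto
    then obtain m where m: "\<rho> m < infdist x K" using \<rho>_less by blast
    obtain D where D: "(F m has_derivative D) (at x)"
      using slope_le_differentiable[OF F_slope[of m x]] by (auto simp: differentiable_def)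
    have "F m y = f y" if y: "\<rho> m < infdist y K" for y
      unfolding F_def f_def
    proof (rule suminf_finite[symmetric])
      show "h k y = 0" if "k \<notin> {..<m}" for k
        by (rule h_0) (use \<rho>_mono[of m k] y that in auto)
    qed simp
    then have "(f has_derivative D) (at x)"
      by (intro has_derivative_transform_within_open[OF D, of "{y. \<rho> m < infdist y K}"])
        (use m in \<open>auto intro!: open_Collect_less continuous_intros\<close>)
    then show ?thesis by (auto simp: differentiable_def)
  qed
  have "oscillates f x (c / 2)" if x: "x \<in> K" for x
  proof -
    have F_inc: "\<bar>F k (x + v) - F k x\<bar> \<le> 2 * \<theta> * norm v" if v: "norm v \<le> \<rho> k" for k v
    proof -
      have "F k (x + v) - F k x = (\<Sum>j<k. h j (x + v) - h j x)" by (simp add: F_def sum_subtractf)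
      also have "\<bar>\<dots>\<bar> \<le> (\<Sum>j<k. \<delta> j * norm v)"
      proof (rule order_trans[OF sum_abs sum_mono])
        fix j assume "j \<in> {..<k}"
        then have "norm v < r j" using v \<rho>_mono[of "Suc j" k] r[of j] by (simp add: \<rho>_Suc)
        then show "\<bar>h j (x + v) - h j x\<bar> \<le> \<delta> j * norm v"
          by (rule slope_le_increment_infdist[OF x]) (rule h_flat)
      qed
      also have "\<dots> \<le> 2 * \<theta> * norm v"
        unfolding sum_distrib_right[symmetric] using \<delta>_sum by (intro mult_right_mono) auto
      finally show ?thesis .
    qed
    have "\<exists>v. v \<noteq> 0 \<and> norm v < e \<and> c / 2 * norm v \<le> \<bar>f (x + v) - f x\<bar>" if e: "e > 0" for e
    proof -
      obtain k where k: "\<rho> k < e" using \<rho>_less[OF e] by blast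
      obtain v where v: "r k \<le> norm v" "norm v \<le> \<rho> k" "\<bar>h k (x + v) - h k x\<bar> \<ge> c * norm v"
        using h_osc[OF x] by blast
      have FS: "F (Suc k) y = F k y + h k y" for y by (simp add: F_def)
      have "2 * \<theta> * \<rho> (Suc k) \<le> \<theta> * norm v" using v(1) \<theta> by (simp add: \<rho>_Suc)
      then have "\<bar>f (x + v) - F (Suc k) (x + v)\<bar> \<le> \<theta> * norm v" "\<bar>f x - F (Suc k) x\<bar> \<le> \<theta> * norm v"
        using tail[of "x + v" "Suc k"] tail[of x "Suc k"] by auto
      then have "\<bar>f (x + v) - f x\<bar> \<ge> c * norm v - 4 * (\<theta> * norm v)"
        using F_inc[OF v(2)] v(3) unfolding FS by linarith
      moreover have "4 * (\<theta> * norm v) \<le> c / 2 * norm v" using c by (simp add: \<theta>_def)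
      ultimately have "c / 2 * norm v \<le> \<bar>f (x + v) - f x\<bar>" by simp
      moreover have "v \<noteq> 0" using v(1) r[of k] by auto
      ultimately show ?thesis using v k by (intro exI[of _ v]) auto
    qed
    moreover have "\<exists>r>0. r < e \<and> (\<forall>v. norm v = r \<longrightarrow> \<bar>f (x + v) - f x\<bar> \<le> c / 2 / 4 * norm v)" if e: "e > 0" for e
    proof -
      obtain k where k: "\<rho> k < e" using \<rho>_less[OF e] by blast
      have "\<bar>f (x + v) - f x\<bar> \<le> c / 2 / 4 * norm v" if v: "norm v = \<rho> k" for v
      proof -
        \<comment> \<open>\<open>2 * \<theta>\<close> from the stages before \<open>k\<close>, which
          are flat, and \<open>2 * \<theta>\<close> from the size of the tail at each of the two
          points.\<close>
        have "\<bar>f (x + v) - f x\<bar> \<le> 6 * (\<theta> * norm v)"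
          using F_inc[of v k] tail[of "x + v" k] tail[of x k] v by simp
        also have "\<dots> \<le> c / 2 / 4 * norm v" using c by (simp add: \<theta>_def)
        finally show ?thesis .
      qed
      then show ?thesis using k \<rho>[of k] by blast
    qed
    ultimately show ?thesis by (simp add: oscillates_def)
  qed
  then show ?thesis using c lip bdd diff
    by (intro exI[of _ f] exI[of _ "c / 2"] exI[of _ L]) auto
qed

text \<open>The bounds must be uniform over all pieces to be summed with prescribed weights; only
  the oscillation constant may depend on \<open>K\<close>.\<close>

lemma normalized_oscillation:
  fixes K :: "(real^'n) set"
  assumes K: "compact K" and cu: "cone_unrectifiable K"
  shows "\<exists>f c. c > 0 \<and> 1-lipschitz_on UNIV f \<and> (\<forall>x. \<bar>f x\<bar> \<le> 1) \<and>
    (\<forall>x\<in>-K. f differentiable (at x)) \<and> (\<forall>x\<in>K. oscillates f x c)"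
proof (cases "K = {}")
  case True
  then show ?thesis
    by (intro exI[of _ "\<lambda>_. 0"] exI[of _ 1]) (auto simp: lipschitz_on_def)
next
  case False
  then obtain f c L where c: "c > 0" and lip: "L-lipschitz_on UNIV f" and bdd: "\<And>x. \<bar>f x\<bar> \<le> L"
    and diff: "\<And>x. x \<in> - K \<Longrightarrow> f differentiable (at x)" and osc: "\<And>x. x \<in> K \<Longrightarrow> oscillates f x c"
    using compact_set_oscillation[OF K _ cu] by blast
  have L: "L \<ge> 0" by (rule lipschitz_on_nonneg[OF lip])
  define a where "a = 1 / (L + 1)"
  have a: "a > 0" "a * L \<le> 1" using L by (auto simp: a_def)
  have "1-lipschitz_on UNIV (\<lambda>x. a * f x)"
  proof (rule lipschitz_onI)
    fix x y
    have "dist (a * f x) (a * f y) = a * dist (f x) (f y)"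
      using a by (simp add: dist_real_def abs_mult flip: right_diff_distrib)
    also have "\<dots> \<le> a * (L * dist x y)" using lipschitz_onD[OF lip] a by (intro mult_left_mono) auto
    also have "\<dots> \<le> 1 * dist x y" unfolding mult.assoc[symmetric] using a by (intro mult_right_mono) auto
    finally show "dist (a * f x) (a * f y) \<le> 1 * dist x y" .
  qed simp
  moreover have "\<bar>a * f x\<bar> \<le> 1" for x
  proof -
    have "\<bar>a * f x\<bar> = a * \<bar>f x\<bar>" using a by (simp add: abs_mult)
    also have "\<dots> \<le> a * L" using bdd a by (intro mult_left_mono) auto
    finally show ?thesis using a by linarith
  qed
  moreover have "(\<lambda>x. a * f x) differentiable (at x)" if "x \<in> - K" for x
    by (intro differentiable_mult differentiable_const diff that)
  ultimately show ?thesis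
    using a c oscillates_scale[OF osc] by (intro exI[of _ "\<lambda>x. a * f x"] exI[of _ "a * c"]) auto
qed

subsection \<open>Countable unions\<close>

text \<open>
  The weights decrease so fast that at a point of \<open>K j\<close>, with \<open>j\<close> minimal, the later terms cannot
  cancel the oscillation of the \<open>j\<close>-th one.
\<close>

lemma weighted_sum_dichotomy:
  fixes f :: "nat \<Rightarrow> 'a::real_normed_vector \<Rightarrow> real"
  assumes c: "\<And>j. c j > 0" and lip: "\<And>j. 1-lipschitz_on UNIV (f j)" and bdd: "\<And>j x. \<bar>f j x\<bar> \<le> 1"
    and diff: "\<And>j x. x \<notin> K j \<Longrightarrow> f j differentiable (at x)"
    and osc: "\<And>j x. x \<in> K j \<Longrightarrow> oscillates (f j) x (c j)"
  shows "\<exists>G :: 'a \<Rightarrow> real. 2-lipschitz_on UNIV G \<and> (\<forall>x\<in>(\<Union>j. K j). \<not> G differentiable (at x)) \<and>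
    (\<forall>x. x \<notin> (\<Union>j. K j) \<longrightarrow> G differentiable (at x))"
proof -
  \<comment> \<open>The factor \<open>c j / 16\<close> yields a tail of at most
    \<open>2 * w (Suc j) \<le> w j * c j / 8\<close>, the perturbation that an oscillation of size
    \<open>w j * c j\<close> tolerates; the minimum with 1 keeps the decay geometric.\<close>
  define w where "w = rec_nat 1 (\<lambda>j p. p * min 1 (c j) / 16)"
  have w_Suc: "w (Suc j) = w j * min 1 (c j) / 16" for j by (simp add: w_def)
  have w: "w j > 0" for j by (induction j) (use c in \<open>auto simp: w_def\<close>)
  have w_le: "w (Suc j) \<le> w j / 16" "w (Suc j) \<le> w j * c j / 16" for j
    using mult_left_mono[of "min 1 (c j)" 1 "w j"] mult_left_mono[of "min 1 (c j)" "c j" "w j"] w[of j]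
    by (auto simp: w_Suc)
  have w_pow: "w j \<le> (1/2)^j" for j
  proof (induction j)
    case (Suc j)
    then show ?case using w_le(1)[of j] w[of j] by simp
  qed (simp add: w_def)
  have w_tail: "(\<Sum>j=m..<N. w j) \<le> 2 * w m" if "m \<le> N" for m N
  proof -
    have "(\<Sum>j=m..<N. w j) \<le> 2 * w m - 2 * w N" using that
    proof (induction rule: dec_induct)
      case (step n)
      then show ?case using w_le(1)[of n] w[of n] by simp
    qed simp
    then show ?thesis using w[of N] by simp
  qed
  \<comment> \<open>Stated for general bounded coefficients, as it serves values, increments and
    derivatives alike.\<close>
  have summ: "summable (\<lambda>j. w j * a j)" if a: "\<And>j. \<bar>a j\<bar> \<le> t" for a :: "nat \<Rightarrow> real" and t
  proof (rule summable_comparison_test')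
    show "summable (\<lambda>j. (1/2)^j * t)" by (intro summable_mult2 summable_geometric) simp
    show "norm (w j * a j) \<le> (1/2)^j * t" for j
      using w[of j] w_pow[of j] a[of j] by (auto simp: abs_mult intro!: mult_mono)
  qed
  have tail: "\<bar>(\<Sum>j. w j * a j) - (\<Sum>j<m. w j * a j)\<bar> \<le> 2 * w m * t" if a: "\<And>j. \<bar>a j\<bar> \<le> t"
    for a :: "nat \<Rightarrow> real" and t m
  proof -
    have t: "t \<ge> 0" using a[of 0] by linarith
    have "\<bar>(\<Sum>j<N. w j * a j) - (\<Sum>j<m. w j * a j)\<bar> \<le> 2 * w m * t" if N: "N \<ge> m" for N
    proof -
      have "(\<Sum>j<N. w j * a j) - (\<Sum>j<m. w j * a j) = (\<Sum>j=m..<N. w j * a j)"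
        using N by (simp add: sum_diff_nat_ivl[of 0 m N, symmetric] lessThan_atLeast0)
      also have "\<bar>\<dots>\<bar> \<le> (\<Sum>j=m..<N. w j * t)"
        by (rule order_trans[OF sum_abs sum_mono]) (use w a in \<open>simp add: abs_mult less_imp_le\<close>)
      also have "\<dots> \<le> 2 * w m * t"
        unfolding sum_distrib_right[symmetric] using w_tail[OF N] t by (rule mult_right_mono)
      finally show ?thesis .
    qed
    moreover have "(\<lambda>N. \<bar>(\<Sum>j<N. w j * a j) - (\<Sum>j<m. w j * a j)\<bar>) \<longlonglongrightarrow> \<bar>(\<Sum>j. w j * a j) - (\<Sum>j<m. w j * a j)\<bar>"
      by (intro tendsto_intros summable_LIMSEQ summ[OF a])
    ultimately show ?thesis by (intro LIMSEQ_le_const2) auto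
  qed
  have inc: "\<bar>f j y - f j x\<bar> \<le> norm (y - x)" for j x y
    using lipschitz_onD[OF lip, of y x] by (simp add: dist_norm)
  define P where "P m x = (\<Sum>j<m. w j * f j x)" for m x
  define G where "G x = (\<Sum>j. w j * f j x)" for x
  have G_tail: "\<bar>(G y - P m y) - (G x - P m x)\<bar> \<le> 2 * w m * norm (y - x)" for m x y
  proof -
    have "(\<Sum>j. w j * (f j y - f j x)) = G y - G x"
      unfolding G_def right_diff_distrib by (intro suminf_diff[symmetric] summ[OF bdd])
    moreover have "(\<Sum>j<m. w j * (f j y - f j x)) = P m y - P m x"
      by (simp add: P_def right_diff_distrib sum_subtractf)
    ultimately show ?thesis using tail[of "\<lambda>j. f j y - f j x" "norm (y - x)" m, OF inc]
      by (simp add: algebra_simps)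
  qed
  have lip_G: "2-lipschitz_on UNIV G"
  proof (rule lipschitz_onI)
    show "dist (G x) (G y) \<le> 2 * dist x y" for x y
      using G_tail[of x 0 y] by (simp add: P_def w_def dist_norm)
  qed simp
  have nondiff: "\<not> G differentiable (at x)" if x: "x \<in> (\<Union>j. K j)" for x
  proof
    assume G: "G differentiable (at x)"
    define j where "j = (LEAST j. x \<in> K j)"
    have j: "x \<in> K j" using x unfolding j_def by (auto intro: LeastI)
    have before: "x \<notin> K i" if "i < j" for i using not_less_Least that unfolding j_def by blast
    \<comment> \<open>By minimality of \<open>j\<close> the earlier terms are differentiable at
      \<open>x\<close> and can be subtracted.\<close>
    have "P j differentiable (at x)"
      unfolding P_def
    proof (rule differentiable_sum)
      show "\<forall>i\<in>{..<j}. (\<lambda>y. w i * f i y) differentiable (at x)"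
        by (intro ballI differentiable_mult differentiable_const diff before) simp
    qed simp
    then have "(\<lambda>y. G y - P j y) differentiable (at x)" by (intro differentiable_diff G)
    moreover have "(\<lambda>y. G y - P j y) = (\<lambda>y. w j * f j y + (G y - P (Suc j) y))"
      by (simp add: P_def)
    moreover have "\<not> (\<lambda>y. w j * f j y + (G y - P (Suc j) y)) differentiable (at x)"
    proof (rule oscillates_perturbed_not_differentiable)
      show "oscillates (\<lambda>y. w j * f j y) x (w j * c j)" by (rule oscillates_scale[OF osc[OF j] w])
      show "w j * c j > 0" using w c by simp
      fix v
      have "\<bar>(G (x + v) - P (Suc j) (x + v)) - (G x - P (Suc j) x)\<bar> \<le> 2 * w (Suc j) * norm v"
        using G_tail[of "x + v" "Suc j" x] by simp
      also have "\<dots> \<le> w j * c j / 8 * norm v" using w_le(2)[of j] by (intro mult_right_mono) auto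
      finally show "\<bar>(G (x + v) - P (Suc j) (x + v)) - (G x - P (Suc j) x)\<bar> \<le> w j * c j / 8 * norm v" .
    qed
    ultimately show False by simp
  qed
  have diff_G: "G differentiable (at x)" if x: "x \<notin> (\<Union>j. K j)" for x
  proof -
    have "\<forall>j. \<exists>D. (f j has_derivative D) (at x)" using diff x by (auto simp: differentiable_def)
    then obtain D where D: "\<And>j. (f j has_derivative D j) (at x)" by metis
    have lin: "linear (D j)" for j using D has_derivative_linear by blast
    have D_le: "\<bar>D j v\<bar> \<le> norm v" for j v
    proof -
      have "D j u \<le> norm u" for u
      proof (rule has_derivative_leI[OF D, of 1])
        fix s :: real assume "0 < s"
        then show "f j (x + s *\<^sub>R u) - f j x \<le> s * norm u"
          using inc[of j "x + s *\<^sub>R u" x] by simp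
      qed simp
      from this[of v] this[of "- v"] show ?thesis by (simp add: linear_neg[OF lin])
    qed
    define D' where "D' v = (\<Sum>j. w j * D j v)" for v
    have "bounded_linear D'"
    proof (rule bounded_linear_intro)
      show "D' (u + v) = D' u + D' v" for u v
        unfolding D'_def using suminf_add[OF summ[OF D_le[of _ u]] summ[OF D_le[of _ v]]]
        by (simp add: linear_add[OF lin] distrib_left)
      show "D' (s *\<^sub>R v) = s *\<^sub>R D' v" for s v
        unfolding D'_def using suminf_mult[OF summ[OF D_le[of _ v]], of s]
        by (simp add: linear_scale[OF lin] mult.left_commute)
      show "norm (D' v) \<le> norm v * 2" for v
        unfolding D'_def using tail[of "\<lambda>j. D j v" "norm v" 0, OF D_le] by (simp add: w_def mult.commute)
    qed
    moreover have "\<exists>d>0. \<forall>y. norm (y - x) < d \<longrightarrow> norm (G y - G x - D' (y - x)) \<le> e * norm (y - x)" if e: "e > 0" for e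
    proof -
      \<comment> \<open>The tails of the increment and of the candidate derivative each cost
        \<open>2 * w m\<close>, together at most \<open>e / 2\<close>.\<close>
      obtain m where "(1/2)^m < e / 8"
        using real_arch_pow_inv[of "e / 8" "1/2"] e by auto
      then have m: "4 * w m \<le> e / 2" using w_pow[of m] by simp
      have "(P m has_derivative (\<lambda>v. \<Sum>j<m. w j * D j v)) (at x)"
        unfolding P_def by (intro has_derivative_sum has_derivative_mult_right D)
      moreover have "e / 2 > 0" using e by simp
      ultimately obtain d where d: "d > 0"
        "\<And>y. norm (y - x) < d \<Longrightarrow> norm (P m y - P m x - (\<Sum>j<m. w j * D j (y - x))) \<le> e / 2 * norm (y - x)"
        unfolding has_derivative_at_alt by blast
      have "norm (G y - G x - D' (y - x)) \<le> e * norm (y - x)" if y: "norm (y - x) < d" for y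
      proof -
        have "\<bar>D' (y - x) - (\<Sum>j<m. w j * D j (y - x))\<bar> \<le> 2 * w m * norm (y - x)"
          unfolding D'_def by (rule tail[OF D_le])
        moreover have "4 * w m * norm (y - x) \<le> e / 2 * norm (y - x)" using m by (intro mult_right_mono) auto
        ultimately have "\<bar>G y - G x - D' (y - x)\<bar> \<le> e / 2 * norm (y - x) + e / 2 * norm (y - x)"
          using G_tail[of y m x] d(2)[OF y] unfolding real_norm_def by linarith
        then show ?thesis by simp
      qed
      then show ?thesis using d(1) by blast
    qed
    ultimately have "(G has_derivative D') (at x)" by (simp add: has_derivative_at_alt)
    then show ?thesis by (auto simp: differentiable_def)
  qed
  show ?thesis
    using lip_G nondiff diff_G by blast
qed

theorem corollary1p11:
  fixes E :: "(real^'n) set" and \<F> :: "(real^'n) set set"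
  assumes "countable \<F>"
    and "\<And>S. S \<in> \<F> \<Longrightarrow> fsigma S \<and> cone_unrectifiable S"
    and "E = \<Union>\<F>"
  shows "\<exists>f :: real^'n \<Rightarrow> real.
           (\<exists>L. L-lipschitz_on UNIV f) \<and>
           (\<forall>x\<in>E. \<not> f differentiable (at x)) \<and>
           (\<forall>x\<in>-E. f differentiable (at x))"
proof -
  have "\<forall>S\<in>\<F>. \<exists>C::nat \<Rightarrow> (real^'n) set. range C \<subseteq> Collect compact \<and> S = \<Union>(C ` UNIV)"
    using assms(2) fsigma_Union_compact by blast
  then obtain C :: "(real^'n) set \<Rightarrow> nat \<Rightarrow> (real^'n) set"
    where C: "\<And>S. S \<in> \<F> \<Longrightarrow> range (C S) \<subseteq> Collect compact \<and> S = \<Union>(C S ` UNIV)" by metis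
  \<comment> \<open>The empty set keeps the family nonempty, so that \<open>from_nat_into\<close>
    enumerates it even if \<F> is empty.\<close>
  define \<K> where "\<K> = insert {} (\<Union>S\<in>\<F>. range (C S))"
  have "countable \<K>" using assms(1) by (simp add: \<K>_def)
  have \<K>: "compact T \<and> cone_unrectifiable T" if T: "T \<in> \<K>" for T
  proof (cases "T = {}")
    case False
    then obtain S n where S: "S \<in> \<F>" "T = C S n" using T unfolding \<K>_def by blast
    then have "T \<subseteq> S" "compact T" using C[OF S(1)] by auto
    then show ?thesis using assms(2)[OF S(1)] cone_unrectifiable_subset by blast
  qed (simp add: cone_unrectifiable_def)
  have union: "\<Union>\<K> = E" using C assms(3) unfolding \<K>_def by fastforce
  define K where "K = from_nat_into \<K>"
  have K_in: "K j \<in> \<K>" for j unfolding K_def by (rule from_nat_into) (simp add: \<K>_def)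
  have "range K = \<K>" unfolding K_def by (rule range_from_nat_into) (simp_all add: \<K>_def assms(1))
  then have K_union: "(\<Union>j. K j) = E" using union by simp
  define Q where "Q j f c \<longleftrightarrow> c > 0 \<and> 1-lipschitz_on UNIV f \<and> (\<forall>x. \<bar>f x\<bar> \<le> 1) \<and>
      (\<forall>x\<in>-K j. f differentiable (at x)) \<and> (\<forall>x\<in>K j. oscillates f x c)" for j f c
  have "\<exists>f c. Q j f c" for j
    unfolding Q_def using normalized_oscillation \<K>[OF K_in] by blast
  then obtain f c where "\<And>j. Q j (f j) (c j)" by metis
  then have fc: "\<And>j. c j > 0" "\<And>j. 1-lipschitz_on UNIV (f j)" "\<And>j x. \<bar>f j x\<bar> \<le> 1"
    "\<And>j x. x \<notin> K j \<Longrightarrow> f j differentiable (at x)" "\<And>j x. x \<in> K j \<Longrightarrow> oscillates (f j) x (c j)"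
    unfolding Q_def by simp_all
  have "\<exists>G :: real^'n \<Rightarrow> real. 2-lipschitz_on UNIV G \<and> (\<forall>x\<in>E. \<not> G differentiable (at x)) \<and>
      (\<forall>x. x \<notin> E \<longrightarrow> G differentiable (at x))"
    unfolding K_union[symmetric] by (rule weighted_sum_dichotomy[of c f K]) (fact fc)+
  then obtain G :: "real^'n \<Rightarrow> real" where
    "2-lipschitz_on UNIV G" "\<forall>x\<in>E. \<not> G differentiable (at x)" "\<forall>x. x \<notin> E \<longrightarrow> G differentiable (at x)"
    by blast
  then show ?thesis by (intro exI[of _ G] conjI exI[of _ 2]) simp_all
qed

end
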